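(* A graph is both a quasi-hamiltonian pseudo-outerplanar graph and a series-parallel graph if and only if it is outerplanar. In symbols, $\mathcal{P}_H\cap\mathcal{S}=\mathcal{O}$.
   Context: All graphs are finite, simple and undirected. A block is a maximal 2-connected subgraph; bridges are blocks too. A graph is pseudo-outerplanar if each of its blocks can be drawn in the plane so that its vertices lie on a fixed circle, its edges lie inside the disk bounded by that circle, and each edge crosses at most one other edge. A graph is quasi-hamiltonian if each of its blocks is hamiltonian; blocks that are single edges or single vertices count as hamiltonian. $\mathcal{P}_H$ is the class of quasi-hamiltonian pseudo-outerplanar graphs. $\mathcal{S}$ is the class of series-parallel graphs, i.e. graphs with no $K_4$ minor. $\mathcal{O}$ is the class of outerplanar graphs. *)

theory Defs
  imports "HOL-Analysis.Analysis" "Graph_Theory.Kuratowski"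
begin

text \<open>
  A finite simple undirected graph is a \<open>pair_graph\<close> of Graph Theory: a finite loop-free symmetric
  digraph without parallel arcs.  The name \<open>connected\<close> is qualified below, because both the
  topological and the graph-theoretic notion are in scope; the graph-theoretic one is false for the
  graph without vertices.
\<close>

subsection \<open>Blocks\<close>

definition two_connected :: "'a pair_pre_digraph \<Rightarrow> bool" where
  "two_connected G \<longleftrightarrow>
     pair_graph G \<and> 3 \<le> card (pverts G) \<and> Digraph_Component.connected (with_proj G) \<and>
     (\<forall>v \<in> pverts G. Digraph_Component.connected (pre_digraph.del_vert (with_proj G) v))"

definition is_bridge :: "'a pair_pre_digraph \<Rightarrow> 'a \<Rightarrow> 'a \<Rightarrow> bool" where
  "is_bridge G u v \<longleftrightarrow>
     (u, v) \<in> parcs G \<and>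
     \<not> u \<rightarrow>\<^sup>*\<^bsub>with_proj (G\<lparr>parcs := parcs G - {(u, v), (v, u)}\<rparr>)\<^esub> v"

text \<open>
  The third alternative covers isolated vertices, so that every graph is the union of its blocks.
\<close>

definition is_block :: "'a pair_pre_digraph \<Rightarrow> 'a pair_pre_digraph \<Rightarrow> bool" where
  "is_block B G \<longleftrightarrow>
     (two_connected B \<and> subgraph (with_proj B) (with_proj G) \<and>
       (\<forall>H. two_connected H \<and> subgraph (with_proj H) (with_proj G) \<and>
            subgraph (with_proj B) (with_proj H) \<longrightarrow> H = B)) \<or>
     (\<exists>u v. is_bridge G u v \<and> B = \<lparr>pverts = {u, v}, parcs = {(u, v), (v, u)}\<rparr>) \<or>
     (\<exists>v \<in> pverts G. (\<forall>w. (v, w) \<notin> parcs G) \<and> B = \<lparr>pverts = {v}, parcs = {}\<rparr>)"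

subsection \<open>Quasi-hamiltonian graphs\<close>

text \<open>
  In a symmetric digraph, going back and forth along one edge is a \<open>cycle\<close> of length 2; the
  cardinality condition excludes it.
\<close>

definition hamiltonian :: "'a pair_pre_digraph \<Rightarrow> bool" where
  "hamiltonian G \<longleftrightarrow>
     3 \<le> card (pverts G) \<and> (\<exists>p. pre_digraph.cycle (with_proj G) p \<and> fst ` set p = pverts G)"

text \<open>
  The blocks with one or two vertices are exactly the single vertices and the single edges.
\<close>

definition quasi_hamiltonian :: "'a pair_pre_digraph \<Rightarrow> bool" where
  "quasi_hamiltonian G \<longleftrightarrow>
     (\<forall>B. is_block B G \<longrightarrow> card (pverts B) = 1 \<or> card (pverts B) = 2 \<or> hamiltonian B)"

subsection \<open>Minors and series-parallel graphs\<close>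

text \<open>\<open>\<phi> x\<close> is the branch set of the vertex \<open>x\<close> of \<open>H\<close>.\<close>

definition is_minor :: "'b pair_pre_digraph \<Rightarrow> 'a pair_pre_digraph \<Rightarrow> bool" where
  "is_minor H G \<longleftrightarrow>
     (\<exists>\<phi> :: 'b \<Rightarrow> 'a set.
        (\<forall>x \<in> pverts H. \<phi> x \<subseteq> pverts G \<and>
            Digraph_Component.connected (induce_subgraph (with_proj G) (\<phi> x))) \<and>
        (\<forall>x \<in> pverts H. \<forall>y \<in> pverts H. x \<noteq> y \<longrightarrow> \<phi> x \<inter> \<phi> y = {}) \<and>
        (\<forall>(x, y) \<in> parcs H. \<exists>u \<in> \<phi> x. \<exists>v \<in> \<phi> y. (u, v) \<in> parcs G))"

definition series_parallel :: "'a pair_pre_digraph \<Rightarrow> bool" where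
  "series_parallel G \<longleftrightarrow>
     \<not> (\<exists>K :: nat pair_pre_digraph. K\<^bsub>4\<^esub> (with_proj K) \<and> is_minor K G)"

subsection \<open>Drawings in the plane\<close>

definition uedges :: "'a pair_pre_digraph \<Rightarrow> 'a set set" where
  "uedges G = (\<lambda>(u, v). {u, v}) ` parcs G"

text \<open>
  Vertices are placed at distinct points of the plane, and each edge is drawn as a simple arc that
  joins its two ends and contains no other vertex.  Drawings may have crossings.
\<close>

definition is_drawing ::
  "'a pair_pre_digraph \<Rightarrow> ('a \<Rightarrow> complex) \<Rightarrow> ('a set \<Rightarrow> real \<Rightarrow> complex) \<Rightarrow> bool" where
  "is_drawing G pos \<gamma> \<longleftrightarrow>
     inj_on pos (pverts G) \<and>
     (\<forall>e \<in> uedges G.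
        arc (\<gamma> e) \<and> {pathstart (\<gamma> e), pathfinish (\<gamma> e)} = pos ` e \<and>
        path_image (\<gamma> e) \<inter> pos ` pverts G = pos ` e)"

text \<open>
  Two edges cross if they meet in a point that is not an end of either; edges with a common end may
  cross as well.
\<close>

definition crossing ::
  "('a \<Rightarrow> complex) \<Rightarrow> ('a set \<Rightarrow> real \<Rightarrow> complex) \<Rightarrow> 'a set \<Rightarrow> 'a set \<Rightarrow> bool" where
  "crossing pos \<gamma> e f \<longleftrightarrow>
     e \<noteq> f \<and> (path_image (\<gamma> e) - pos ` e) \<inter> (path_image (\<gamma> f) - pos ` f) \<noteq> {}"

definition drawing_image ::
  "'a pair_pre_digraph \<Rightarrow> ('a \<Rightarrow> complex) \<Rightarrow> ('a set \<Rightarrow> real \<Rightarrow> complex) \<Rightarrow> complex set" where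
  "drawing_image G pos \<gamma> = pos ` pverts G \<union> (\<Union>e \<in> uedges G. path_image (\<gamma> e))"

subsection \<open>Outerplanar and pseudo-outerplanar graphs\<close>

text \<open>
  A graph is outerplanar if it has a plane drawing with all vertices on the boundary of the outer
  face.  The outer face is the unbounded component of the complement of the drawing, that is,
  \<open>outside\<close> of its image.
\<close>

definition outerplanar :: "'a pair_pre_digraph \<Rightarrow> bool" where
  "outerplanar G \<longleftrightarrow>
     (\<exists>pos \<gamma>. is_drawing G pos \<gamma> \<and>
        (\<forall>e \<in> uedges G. \<forall>f \<in> uedges G. \<not> crossing pos \<gamma> e f) \<and>
        pos ` pverts G \<subseteq> frontier (outside (drawing_image G pos \<gamma>)))"

definition pseudo_outerplanar :: "'a pair_pre_digraph \<Rightarrow> bool" where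
  "pseudo_outerplanar G \<longleftrightarrow>
     (\<forall>B. is_block B G \<longrightarrow>
        (\<exists>c r pos \<gamma>. 0 < r \<and> is_drawing B pos \<gamma> \<and>
           pos ` pverts B \<subseteq> sphere c r \<and>
           (\<forall>e \<in> uedges B. path_image (\<gamma> e) \<subseteq> cball c r) \<and>
           (\<forall>e \<in> uedges B. card {f \<in> uedges B. crossing pos \<gamma> e f} \<le> 1)))"

subsection \<open>The graph classes\<close>

definition PH_graphs :: "'a pair_pre_digraph set" where
  "PH_graphs = {G. pair_graph G \<and> quasi_hamiltonian G \<and> pseudo_outerplanar G}"

definition S_graphs :: "'a pair_pre_digraph set" where
  "S_graphs = {G. pair_graph G \<and> series_parallel G}"

definition O_graphs :: "'a pair_pre_digraph set" where
  "O_graphs = {G. pair_graph G \<and> outerplanar G}"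

end

theory Submission
  imports Defs
begin

text \<open>
  The bridge between the two sides is a combinatorial notion: an injective placement of the vertices
  on the line such that no two edges interleave.  Placing the vertices in this order on a circle and
  drawing the edges as chords shows that such a graph is outerplanar and pseudo-outerplanar, and it has
  no \<open>K\<^sub>4\<close> minor because disjoint connected vertex sets cannot interleave.

  If every block has a hamiltonian cycle and there is no \<open>K\<^sub>4\<close> minor, then no two chords of such a
  cycle cross, so each block has a noncrossing order, and these orders can be glued along cut vertices.

  In a plane drawing with all vertices on the outer face, Janiszewski's theorem shows that of three
  internally disjoint paths with common ends one runs inside the cycle formed by the other two, so
  they cannot all have inner vertices.  Hence a longest cycle of a block is hamiltonian, since a path
  leaving and re-entering the cycle would either prolong it or complete such a triple.  The same
  theorem excludes crossing chords of a cycle.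
\<close>

text \<open>The two excluded configurations are those of the classical characterization of
  outerplanar graphs by the minors K_{2,3} and K_4. \<open>theta_free\<close> forbids subdivisions
  of K_{2,3}; a \<open>crossed_cycle\<close> is a K_4 made of a cycle and two crossing chords. Both
  inclusions pass through \<open>hamiltonian_blocks_noncrossing\<close>, but exclude crossed cycles
  for different reasons: contraction of four arcs on one side, topology on the other. Edges of a
  drawing are arbitrary arcs, so nothing can be read off from coordinates. What is known about the
  plane comes from the Jordan curve theorem and Janiszewski's theorem, and a vertex is outer only in
  the sense that it lies on the frontier of \<open>outside\<close>. The tree of blocks is never
  built. The gluing is an induction on vertex sets that splits a set as long as it is disconnected
  or has a cut vertex; what remains induces a 2-connected subgraph, and such a subgraph lies in some
  block.\<close>

hide_const (open) Digraph_Component.connected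

subsection \<open>Connected vertex sets and walks\<close>

text \<open>One relation \<open>E\<close> serves for all vertex sets, so induced subgraphs and
  vertex deletions only change \<open>X\<close>. Nonemptiness agrees with the library, where the
  empty graph is not connected.\<close>

definition connected_on :: "'a rel \<Rightarrow> 'a set \<Rightarrow> bool" where
  "connected_on E X \<longleftrightarrow> X \<noteq> {} \<and> (\<forall>u \<in> X. \<forall>v \<in> X. (u, v) \<in> rtrancl_on X E)"

text \<open>A path from \<open>u\<close> to \<open>v\<close> has a first step that leaves
  \<open>A\<close>. Most later uses of connectivity go through this edge.\<close>

lemma connected_on_cut:
  assumes "connected_on E X" "u \<in> X" "u \<in> A" "v \<in> X" "v \<notin> A"
  shows "\<exists>x \<in> X \<inter> A. \<exists>y \<in> X - A. (x, y) \<in> E"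
proof -
  have "(u, v) \<in> rtrancl_on X E" using assms by (auto simp: connected_on_def)
  then have "v \<in> A \<or> (\<exists>x \<in> X \<inter> A. \<exists>y \<in> X - A. (x, y) \<in> E)"
    by (induction rule: rtrancl_on_induct) (use assms in auto)
  then show ?thesis using assms by blast
qed

text \<open>The set reached from one vertex inside \<open>X\<close> has no outgoing edge, and by
  symmetry no incoming one.\<close>

lemma not_connected_on_cut:
  assumes "sym E" "X \<noteq> {}" "\<not> connected_on E X"
  obtains A where "A \<subseteq> X" "A \<noteq> {}" "A \<noteq> X" "E \<inter> A \<times> (X - A) = {}" "E \<inter> (X - A) \<times> A = {}"
proof -
  obtain u v where uv: "u \<in> X" "v \<in> X" "(u, v) \<notin> rtrancl_on X E"
    using assms by (auto simp: connected_on_def)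
  let ?A = "{x. (u, x) \<in> rtrancl_on X E}"
  have "E \<inter> ?A \<times> (X - ?A) = {}"
    by (auto intro: rtrancl_on_into_rtrancl_on)
  moreover from this have "E \<inter> (X - ?A) \<times> ?A = {}"
    using assms(1) by (auto dest: symD)
  moreover have "?A \<subseteq> X" by (auto dest: in_rtrancl_on_in_F)
  moreover have "u \<in> ?A" using uv by simp
  ultimately show ?thesis using that[of ?A] uv by blast
qed

lemma connected_on_singleton: "connected_on E {x}"
  by (simp add: connected_on_def)

lemma connected_on_Un:
  assumes "sym E" "connected_on E X" "connected_on E Y" "x \<in> X" "y \<in> Y" "(x, y) \<in> E"
  shows "connected_on E (X \<union> Y)"
proof (rule ccontr)
  assume "\<not> ?thesis"
  then obtain A where A: "A \<subseteq> X \<union> Y" "A \<noteq> {}" "A \<noteq> X \<union> Y"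
    "E \<inter> A \<times> (X \<union> Y - A) = {}" "E \<inter> (X \<union> Y - A) \<times> A = {}"
    using not_connected_on_cut[OF assms(1), of "X \<union> Y"] assms by blast
  have X: "X \<subseteq> A \<or> X \<inter> A = {}"
    using connected_on_cut[OF assms(2)] A by blast
  have Y: "Y \<subseteq> A \<or> Y \<inter> A = {}"
    using connected_on_cut[OF assms(3)] A by blast
  show False using X Y A assms by blast
qed

abbreviation walk :: "'a rel \<Rightarrow> 'a list \<Rightarrow> bool" where
  "walk E \<equiv> successively (\<lambda>x y. (x, y) \<in> E)"

lemma walk_rev: "sym E \<Longrightarrow> walk E (rev xs) \<longleftrightarrow> walk E xs"
  unfolding successively_rev by (rule arg_cong2[where f = successively]) (auto simp: fun_eq_iff dest: symD)

lemma connected_on_walk: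
  assumes "sym E" "walk E xs" "xs \<noteq> []"
  shows "connected_on E (set xs)"
  using assms(3,2)
proof (induction xs rule: list_nonempty_induct)
  case (cons x xs)
  then have "connected_on E ({x} \<union> set xs)"
    by (intro connected_on_Un[OF assms(1) connected_on_singleton, of _ _ x "hd xs"])
       (auto simp: successively_Cons)
  then show ?case by simp
qed (simp add: connected_on_singleton)

text \<open>The part of a path before its first vertex in \<open>C\<close>, made simple by cutting
  out loops.\<close>

lemma exit_path:
  assumes "(w, z) \<in> rtrancl_on X E" "w \<notin> C" "z \<in> C"
  obtains Q b where "Q \<noteq> []" "hd Q = w" "distinct Q" "walk E Q" "set Q \<subseteq> X - C"
    "b \<in> C \<inter> X" "(last Q, b) \<in> E"
proof -
  have "\<exists>Q b. Q \<noteq> [] \<and> hd Q = w \<and> distinct Q \<and> walk E Q \<and> set Q \<subseteq> X - C \<and>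
    b \<in> C \<inter> X \<and> (last Q, b) \<in> E"
    using assms(1,2)
  proof (induction rule: converse_rtrancl_on_induct)
    case base
    then show ?case using assms by blast
  next
    case (step x y)
    show ?case
    proof (cases "y \<in> C")
      case True
      then show ?thesis using step by (intro exI[of _ "[x]"] exI[of _ y]) auto
    next
      case False
      then obtain Q b where Q: "Q \<noteq> []" "hd Q = y" "distinct Q" "walk E Q" "set Q \<subseteq> X - C"
        "b \<in> C \<inter> X" "(last Q, b) \<in> E" using step by blast
      show ?thesis
      proof (cases "x \<in> set Q")
        \<comment> \<open>\<open>x\<close> already occurs on \<open>Q\<close>: the loop is dropped
          by starting at that occurrence.\<close>
        case True
        then obtain Q1 Q2 where "Q = Q1 @ x # Q2" by (meson split_list)
        then show ?thesis using Q
          by (intro exI[of _ "x # Q2"] exI[of _ b]) (auto simp: successively_append_iff)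
      next
        case False
        then show ?thesis using Q step
          by (intro exI[of _ "x # Q"] exI[of _ b]) (auto simp: successively_Cons)
      qed
    qed
  qed
  then show ?thesis using that by blast
qed

subsection \<open>Cycles\<close>

definition cyclic_walk :: "'a rel \<Rightarrow> 'a list \<Rightarrow> bool" where
  "cyclic_walk E xs \<longleftrightarrow> distinct xs \<and> walk E xs \<and> (last xs, hd xs) \<in> E"

lemma cyclic_walk_rotate:
  assumes "cyclic_walk E (xs @ ys)"
  shows "cyclic_walk E (ys @ xs)"
  using assms by (cases "xs = []"; cases "ys = []")
    (auto simp: cyclic_walk_def successively_append_iff)

text \<open>The forbidden configuration is a subdivision of K_{2,3}: three internally disjoint paths
  from \<open>a\<close> to \<open>b\<close>, each with an inner vertex.\<close>

definition theta_free :: "'a rel \<Rightarrow> bool" where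
  "theta_free E \<longleftrightarrow>
     \<not> (\<exists>a b P Q R. P \<noteq> [] \<and> Q \<noteq> [] \<and> R \<noteq> [] \<and> distinct (a # b # P @ Q @ R) \<and>
       walk E (a # P @ [b]) \<and> walk E (a # Q @ [b]) \<and> walk E (a # R @ [b]))"

text \<open>An ear \<open>Q\<close> leaves the cycle at \<open>a\<close> and returns at
  \<open>b\<close>. If \<open>a\<close> and \<open>b\<close> are not neighbours on the cycle, its
  two sides and \<open>Q\<close> violate \<open>theta_free\<close>; if they are, \<open>Q\<close>
  replaces the edge between them.\<close>

lemma longer_cycle:
  assumes E: "sym E" and tf: "theta_free E"
    and C: "cyclic_walk E xs" "2 \<le> length xs" "set xs \<subseteq> V" "set xs \<noteq> V"
    and V: "connected_on E V" "\<And>v. v \<in> V \<Longrightarrow> connected_on E (V - {v})"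
  obtains ys where "cyclic_walk E ys" "set ys \<subseteq> V" "length xs < length ys"
proof -
  obtain w0 where "w0 \<in> V" "w0 \<notin> set xs" using C by blast
  moreover have "hd xs \<in> set xs" using C by (cases xs) auto
  ultimately obtain a w where aw: "a \<in> set xs" "w \<in> V" "w \<notin> set xs" "(a, w) \<in> E"
    using connected_on_cut[OF V(1), of "hd xs" "set xs" w0] C by blast
  obtain xs1 xs2 where xs: "xs = xs1 @ a # xs2" using aw by (meson split_list)
  \<comment> \<open>The cycle is rotated so as to start at \<open>a\<close>.\<close>
  define R where "R = xs2 @ xs1"
  have cR: "cyclic_walk E (a # R)"
    using cyclic_walk_rotate[of E xs1 "a # xs2"] C xs by (simp add: R_def)
  have len: "length (a # R) = length xs" and setR: "set xs = insert a (set R)"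
    by (auto simp: xs R_def)
  have aR: "a \<notin> set R" using cR by (simp add: cyclic_walk_def)
  have "R \<noteq> []" using C len by auto
  then obtain z where "z \<in> set R" by fastforce
  \<comment> \<open>Here the absence of cut vertices enters: the return path is found in
    \<open>V - {a}\<close>, so that \<open>b\<close> differs from \<open>a\<close>.\<close>
  then have "(w, z) \<in> rtrancl_on (V - {a}) E"
    using V(2)[of a] aw C setR aR by (auto simp: connected_on_def)
  then obtain Q b where Q: "Q \<noteq> []" "hd Q = w" "distinct Q" "walk E Q"
    "set Q \<subseteq> V - {a} - set R" "b \<in> set R \<inter> (V - {a})" "(last Q, b) \<in> E"
    using exit_path[of w z "V - {a}" E "set R"] aw setR \<open>z \<in> set R\<close> by blast
  then obtain R1 R2 where R: "R = R1 @ b # R2" by (meson IntE split_list)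
  have d: "distinct (a # R1 @ b # R2)" "set Q \<inter> set (a # R1 @ b # R2) = {}"
    using cR Q by (auto simp: cyclic_walk_def R)
  have w1: "walk E (a # R1 @ [b])" "walk E (b # R2 @ [a])"
  proof -
    have "walk E ((a # R1 @ [b]) @ R2)" "walk E ((a # R1) @ (b # R2))" "(last (b # R2), a) \<in> E"
      using cR by (auto simp: cyclic_walk_def R)
    then show "walk E (a # R1 @ [b])" "walk E (b # R2 @ [a])"
      using successively_append_iff[of _ "a # R1 @ [b]" R2] successively_append_iff[of _ "a # R1" "b # R2"]
        successively_append_iff[of _ "b # R2" "[a]"] by auto
  qed
  have w2: "walk E (a # rev R2 @ [b])"
    using w1(2) walk_rev[OF E, of "b # R2 @ [a]"] by simp
  have w3: "walk E (a # Q @ [b])"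
    using Q aw by (auto simp: successively_append_iff successively_Cons)
  have w4: "walk E (b # rev Q @ [a])"
    using w3 walk_rev[OF E, of "a # Q @ [b]"] by simp
  have "R1 = [] \<or> R2 = []"
  proof (rule ccontr)
    assume *: "\<not> ?thesis"
    have "distinct (a # b # R1 @ rev R2 @ Q)" using d Q by auto
    then show False using tf w1 w2 w3 * Q unfolding theta_free_def
      by (metis rev_is_Nil_conv)
  qed
  then show ?thesis
  proof
    assume "R1 = []"
    have "cyclic_walk E (a # Q @ b # R2)"
      using w3 w1(2) d Q by (cases R2) (auto simp: cyclic_walk_def successively_append_iff successively_Cons)
    moreover have "length xs < length (a # Q @ b # R2)"
      using len R \<open>R1 = []\<close> Q by (cases Q) auto
    moreover have "set (a # Q @ b # R2) \<subseteq> V"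
      using C setR R Q by auto
    ultimately show ?thesis using that by blast
  next
    assume "R2 = []"
    \<comment> \<open>Now the closing edge from \<open>b\<close> to \<open>a\<close> is the one
      replaced, so the ear is run backwards.\<close>
    have "cyclic_walk E (a # R1 @ b # rev Q)"
      using w4 w1(1) d Q by (auto simp: cyclic_walk_def successively_append_iff successively_Cons hd_append)
    moreover have "length xs < length (a # R1 @ b # rev Q)"
      using len R \<open>R2 = []\<close> Q by (cases Q) auto
    moreover have "set (a # R1 @ b # rev Q) \<subseteq> V"
      using C setR R Q by auto
    ultimately show ?thesis using that by blast
  qed
qed

lemma theta_free_hamiltonian:
  assumes E: "sym E" "irrefl E" and tf: "theta_free E" and fin: "finite V"
    and card: "2 \<le> card V"
    and V: "connected_on E V" "\<And>v. v \<in> V \<Longrightarrow> connected_on E (V - {v})"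
  obtains xs where "cyclic_walk E xs" "set xs = V"
proof -
  obtain u v where "u \<in> V" "v \<in> V" "u \<noteq> v"
    using card by (metis card_le_Suc0_iff_eq fin not_less_eq_eq numeral_2_eq_2)
  then obtain y where y: "y \<in> V" "(u, y) \<in> E" "u \<noteq> y"
    using connected_on_cut[OF V(1), of u "{u}" v] by blast
  \<comment> \<open>An edge, traversed back and forth, counts as a cycle here and starts the maximization.\<close>
  let ?P = "\<lambda>xs. cyclic_walk E xs \<and> set xs \<subseteq> V \<and> 2 \<le> length xs"
  have "?P [u, y]" using y \<open>u \<in> V\<close> E by (auto simp: cyclic_walk_def dest: symD)
  moreover have "length xs \<le> card V" if "?P xs" for xs
    using that fin by (metis card_mono cyclic_walk_def distinct_card)
  ultimately obtain xs where xs: "?P xs" "\<And>ys. ?P ys \<Longrightarrow> length ys \<le> length xs"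
    using ex_has_greatest_nat[of ?P "[u, y]" length "Suc (card V)"] by (metis le_imp_less_Suc)
  have "set xs = V"
  proof (rule ccontr)
    assume "set xs \<noteq> V"
    then obtain ys where "cyclic_walk E ys" "set ys \<subseteq> V" "length xs < length ys"
      using longer_cycle[OF E(1) tf _ _ _ _ V, of xs] xs(1) by blast
    then show False using xs by fastforce
  qed
  then show ?thesis using xs that by blast
qed

text \<open>The cycle is cut into four arcs, each starting at an end of a chord. The arcs are the
  future branch sets of a K_4 minor.\<close>

definition crossed_cycle :: "'a rel \<Rightarrow> 'a list \<Rightarrow> 'a list \<Rightarrow> 'a list \<Rightarrow> 'a list \<Rightarrow> bool" where
  "crossed_cycle E A B C D \<longleftrightarrow> A \<noteq> [] \<and> B \<noteq> [] \<and> C \<noteq> [] \<and> D \<noteq> [] \<and>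
     cyclic_walk E (A @ B @ C @ D) \<and> (hd A, hd C) \<in> E \<and> (hd B, hd D) \<in> E"

subsection \<open>Noncrossing orders\<close>

text \<open>A one-page book embedding. Real positions, rather than ranks, make reflecting, rotating
  and gluing plain arithmetic. One orientation of the two edges is tested; for symmetric
  \<open>E\<close> it covers the others.\<close>

definition noncrossing :: "'a set \<Rightarrow> 'a rel \<Rightarrow> ('a \<Rightarrow> real) \<Rightarrow> bool" where
  "noncrossing V E f \<longleftrightarrow> inj_on f V \<and>
     (\<forall>(a, c) \<in> E. \<forall>(b, d) \<in> E. \<not> (f a < f b \<and> f b < f c \<and> f c < f d))"

lemma noncrossingD:
  assumes "noncrossing V E f" "(a, c) \<in> E" "(b, d) \<in> E" "f a < f b" "f b < f c" "f c < f d"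
  shows False
  using assms unfolding noncrossing_def by blast

lemma noncrossingI:
  assumes "inj_on f V"
    and "\<And>a b c d. (a, c) \<in> E \<Longrightarrow> (b, d) \<in> E \<Longrightarrow> f a < f b \<Longrightarrow> f b < f c \<Longrightarrow> f c < f d \<Longrightarrow> False"
  shows "noncrossing V E f"
  using assms unfolding noncrossing_def by blast

lemma noncrossing_injD:
  assumes "noncrossing V E f" "x \<in> V" "y \<in> V" "f x = f y"
  shows "x = y"
  using assms by (auto simp: noncrossing_def inj_on_def)

lemma noncrossing_mono:
  assumes "noncrossing V E f" "W \<subseteq> V" "F \<subseteq> E"
  shows "noncrossing W F f"
proof (rule noncrossingI)
  show "inj_on f W" using assms by (auto simp: noncrossing_def intro: inj_on_subset)
qed (use noncrossingD[OF assms(1)] assms(3) in blast)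

text \<open>The order is that of the positions on the cycle; two interleaving edges would be
  crossing chords.\<close>

lemma noncrossing_cycle:
  assumes xs: "cyclic_walk E xs" "set xs = V"
    and nc: "\<And>A B C D. \<not> crossed_cycle E A B C D"
  obtains f where "noncrossing V (E \<inter> V \<times> V) f"
proof -
  define f where "f x = real (inv_into {..<length xs} (nth xs) x)" for x
  have dist: "distinct xs" using xs by (simp add: cyclic_walk_def)
  have f: "f x < length xs" "xs ! nat \<lfloor>f x\<rfloor> = x" if "x \<in> V" for x
  proof -
    have "x \<in> nth xs ` {..<length xs}" using that xs by (auto simp: in_set_conv_nth)
    then show "f x < length xs" "xs ! nat \<lfloor>f x\<rfloor> = x"
      using inv_into_into[of x "nth xs" "{..<length xs}"] f_inv_into_f[of x "nth xs" "{..<length xs}"]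
      by (auto simp: f_def)
  qed
  have "inj_on f V" using f by (metis inj_onI)
  moreover have False if e: "(a, c) \<in> E \<inter> V \<times> V" "(b, d) \<in> E \<inter> V \<times> V" and lt: "f a < f b" "f b < f c" "f c < f d"
    for a b c d
  proof -
    have V: "a \<in> V" "b \<in> V" "c \<in> V" "d \<in> V" using e by auto
    define i j k l where "i = nat \<lfloor>f a\<rfloor>" "j = nat \<lfloor>f b\<rfloor>" "k = nat \<lfloor>f c\<rfloor>" "l = nat \<lfloor>f d\<rfloor>"
    have lt': "i < j" "j < k" "k < l" "l < length xs"
      using lt f[OF V(4)] unfolding i_j_k_l_def f_def by auto
    have nths: "xs ! i = a" "xs ! j = b" "xs ! k = c" "xs ! l = d"
      using f V by (auto simp: i_j_k_l_def)
    \<comment> \<open>The four arcs start at positions \<open>i\<close>, \<open>j\<close>,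
      \<open>k\<close>, \<open>l\<close>; the last one wraps around the end of the list.\<close>
    let ?A = "drop i (take j xs)" and ?B = "drop j (take k xs)" and ?C = "drop k (take l xs)"
      and ?D = "drop l xs @ take i xs"
    have dt: "drop m (take n xs) @ drop n xs = drop m xs" if "m \<le> n" "n \<le> length xs" for m n
      using that append_take_drop_id[of n xs] by (metis drop_append diff_is_0_eq drop_0 length_take min.absorb2 append_same_eq)
    have "xs = take i xs @ drop i xs" by simp
    moreover have "drop i xs @ take i xs = ?A @ ?B @ ?C @ ?D"
      using dt[of i j, symmetric] dt[of j k, symmetric] dt[of k l, symmetric] lt' by simp
    ultimately have "cyclic_walk E (?A @ ?B @ ?C @ ?D)"
      using cyclic_walk_rotate[of E "take i xs" "drop i xs"] xs by metis
    moreover have "hd ?A = a" "hd ?B = b" "hd ?C = c" "hd ?D = d"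
      using lt' nths by (auto simp: hd_drop_conv_nth hd_append)
    ultimately have "crossed_cycle E ?A ?B ?C ?D"
      using lt' e unfolding crossed_cycle_def by auto
    then show False using nc by blast
  qed
  ultimately have "noncrossing V (E \<inter> V \<times> V) f" by (rule noncrossingI)
  then show ?thesis using that by blast
qed

section \<open>Moving noncrossing orders and gluing them at a vertex\<close>

lemma noncrossing_uminus:
  assumes "sym E" "noncrossing V E f"
  shows "noncrossing V E (\<lambda>x. - f x)"
proof (rule noncrossingI)
  show "inj_on (\<lambda>x. - f x) V" using assms(2) by (auto simp: noncrossing_def inj_on_def)
  show False if "(a, c) \<in> E" "(b, d) \<in> E" "- f a < - f b" "- f b < - f c" "- f c < - f d" for a b c d
    using noncrossingD[OF assms(2), of d b c a] that symD[OF assms(1)] by auto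
qed

lemma noncrossing_shift:
  assumes "noncrossing V E f"
  shows "noncrossing V E (\<lambda>x. f x - c)"
proof (rule noncrossingI)
  show "inj_on (\<lambda>x. f x - c) V" using assms by (auto simp: noncrossing_def inj_on_def)
qed (use noncrossingD[OF assms] in auto)

text \<open>Interleaving depends only on the cyclic order, so any vertex can be made the
  first.\<close>

lemma noncrossing_rotate:
  assumes f: "noncrossing V E f" and E: "sym E" "E \<subseteq> V \<times> V" and "finite V" "v \<in> V"
  obtains g where "noncrossing V E g" "g v = 0" "\<And>x. x \<in> V \<Longrightarrow> 0 \<le> g x"
proof -
  obtain M where M: "\<And>x. x \<in> V \<Longrightarrow> \<bar>f x\<bar> < M"
    using finite_imp_bounded[of "f ` V"] \<open>finite V\<close>
    by (auto simp: bounded_iff intro: that le_less_trans[OF _ less_add_one])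
  \<comment> \<open>Values of \<open>f\<close> differ by less than \<open>2 * M\<close>, so this
    shift moves everything before \<open>v\<close> past the end.\<close>
  define g where "g x = (if f x < f v then f x + 2 * M else f x) - f v" for x
  have g: "f x < f v \<and> g x = f x + 2 * M - f v \<and> \<bar>f x\<bar> < M \<or> f v \<le> f x \<and> g x = f x - f v \<and> \<bar>f x\<bar> < M"
    if "x \<in> V" for x
    using M[OF that] by (auto simp: g_def)
  have "inj_on g V"
  proof (rule inj_onI)
    fix x y assume "x \<in> V" "y \<in> V" "g x = g y"
    then have "f x = f y" using g[of x] g[of y] by linarith
    then show "x = y" using f \<open>x \<in> V\<close> \<open>y \<in> V\<close> by (auto simp: noncrossing_def inj_on_def)
  qed
  moreover have False if e: "(a, c) \<in> E" "(b, d) \<in> E" and lt: "g a < g b" "g b < g c" "g c < g d"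
    for a b c d
  proof -
    have V: "a \<in> V" "b \<in> V" "c \<in> V" "d \<in> V" using e E by auto
    \<comment> \<open>Undoing the rotation leaves one of the four cyclic shifts of the pattern, and
      each is again an interleaving of the same two edges, possibly reversed or exchanged.\<close>
    have "f a < f b \<and> f b < f c \<and> f c < f d \<or> f b < f c \<and> f c < f d \<and> f d < f a \<or>
      f c < f d \<and> f d < f a \<and> f a < f b \<or> f d < f a \<and> f a < f b \<and> f b < f c"
      using g[OF V(1)] g[OF V(2)] g[OF V(3)] g[OF V(4)] lt by (smt (verit))
    then show False
      using noncrossingD[OF f, of a c b d] noncrossingD[OF f, of b d c a]
        noncrossingD[OF f, of c a d b] noncrossingD[OF f, of d b a c]
        e symD[OF E(1)] by blast
  qed
  ultimately have "noncrossing V E g" by (rule noncrossingI)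
  moreover have "g v = 0" by (simp add: g_def)
  moreover have "0 \<le> g x" if "x \<in> V" for x using g[OF that] M[OF \<open>v \<in> V\<close>] by linarith
  ultimately show ?thesis using that by blast
qed

text \<open>\<open>A\<close> occupies the nonnegative half-line and \<open>B\<close> the nonpositive
  one, so edges from different parts cannot interleave; the parts can share only the point
  0.\<close>

lemma noncrossing_glue:
  assumes "noncrossing A (E \<inter> A \<times> A) f" "noncrossing B (E \<inter> B \<times> B) g"
    and "E \<subseteq> A \<times> A \<union> B \<times> B"
    and "\<And>x. x \<in> A \<Longrightarrow> 0 \<le> f x" "\<And>x. x \<in> B \<Longrightarrow> g x \<le> 0"
    and "\<And>x. x \<in> A \<Longrightarrow> x \<in> B \<Longrightarrow> f x = 0 \<and> g x = 0"
    and "\<And>x y. x \<in> A \<Longrightarrow> y \<in> B \<Longrightarrow> f x = 0 \<Longrightarrow> g y = 0 \<Longrightarrow> x = y"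
  shows "noncrossing (A \<union> B) E (\<lambda>x. if x \<in> A then f x else g x)"
proof -
  let ?h = "\<lambda>x. if x \<in> A then f x else g x"
  have hA: "?h x = f x" if "x \<in> A" for x using that by simp
  have hB: "?h x = g x" if "x \<in> B" for x using that assms(6) by simp
  have "inj_on ?h (A \<union> B)"
  proof (rule inj_onI)
    fix x y assume xy: "x \<in> A \<union> B" "y \<in> A \<union> B" "?h x = ?h y"
    have ij: "inj_on f A" "inj_on g B" using assms by (auto simp: noncrossing_def)
    consider "x \<in> A" "y \<in> A" | "x \<in> B" "y \<in> B" | "x \<in> A" "y \<in> B" | "x \<in> B" "y \<in> A"
      using xy by blast
    then show "x = y"
    proof cases
      case 1 then show ?thesis using xy hA ij by (auto simp: inj_on_def)
    next
      case 2 then show ?thesis using xy(3) hB ij by (auto simp: inj_on_def)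
    next
      case 3 then have "f x = g y" using xy(3) hA hB by metis
      then show ?thesis using 3 assms(4)[of x] assms(5)[of y] assms(7)[of x y] by auto
    next
      case 4 then have "f y = g x" using xy(3) hA hB by metis
      then show ?thesis using 4 assms(4)[of y] assms(5)[of x] assms(7)[of y x] by auto
    qed
  qed
  moreover have False if e: "(a, c) \<in> E" "(b, d) \<in> E" and lt: "?h a < ?h b" "?h b < ?h c" "?h c < ?h d"
    for a b c d
  proof -
    have pos: "0 \<le> ?h x" if "x \<in> A" for x using that assms(4) by simp
    have neg: "?h x \<le> 0" if "x \<in> B" for x using that assms(5) hB by metis
    consider "(a, c) \<in> A \<times> A" "(b, d) \<in> A \<times> A" | "(a, c) \<in> B \<times> B" "(b, d) \<in> B \<times> B"
      | "a \<in> A" "b \<in> B" | "c \<in> B" "d \<in> A" "a \<in> B" "b \<in> A"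
      using e assms(3) by blast
    then show False
    proof cases
      case 1 then show ?thesis using noncrossingD[OF assms(1), of a c b d] e lt by auto
    next
      case 2
      then have "g a < g b" "g b < g c" "g c < g d" using lt hB by (metis mem_Sigma_iff)+
      then show ?thesis using noncrossingD[OF assms(2), of a c b d] e 2 by auto
    next
      case 3 then show ?thesis using pos[of a] neg[of b] lt by linarith
    next
      case 4 then show ?thesis using pos[of b] neg[of c] lt by linarith
    qed
  qed
  ultimately show ?thesis by (rule noncrossingI)
qed

lemma noncrossing_glue_at:
  assumes f: "noncrossing A (E \<inter> A \<times> A) f" and g: "noncrossing B (E \<inter> B \<times> B) g"
    and E: "sym E" "E \<subseteq> A \<times> A \<union> B \<times> B" and "finite A" "finite B"
    and "A \<noteq> {}" "B \<noteq> {}" "A \<inter> B \<subseteq> {v}"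
  obtains h where "noncrossing (A \<union> B) E h"
proof -
  obtain a where a: "a \<in> A" "v \<in> A \<Longrightarrow> a = v" using assms by blast
  obtain b where b: "b \<in> B" "v \<in> B \<Longrightarrow> b = v" using assms by blast
  have sy: "sym (E \<inter> A \<times> A)" "sym (E \<inter> B \<times> B)" using E by (auto simp: sym_def)
  obtain f' where f': "noncrossing A (E \<inter> A \<times> A) f'" "f' a = 0" "\<And>x. x \<in> A \<Longrightarrow> 0 \<le> f' x"
    using noncrossing_rotate[OF f sy(1)] assms a by blast
  obtain g' where g': "noncrossing B (E \<inter> B \<times> B) g'" "g' b = 0" "\<And>x. x \<in> B \<Longrightarrow> 0 \<le> g' x"
    using noncrossing_rotate[OF g sy(2)] assms b by blast
  \<comment> \<open>If the parts share \<open>v\<close>, both copies of it stay at 0. If they are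
    disjoint, a gap of 1 keeps the two first vertices \<open>a\<close> and \<open>b\<close>
    apart.\<close>
  define c :: real where "c = (if A \<inter> B = {} then 1 else 0)"
  have ncg: "noncrossing B (E \<inter> B \<times> B) (\<lambda>x. - g' x - c)"
    by (intro noncrossing_shift noncrossing_uminus sy g')
  have inj: "inj_on f' A" "inj_on g' B" using f' g' by (auto simp: noncrossing_def)
  have "noncrossing (A \<union> B) E (\<lambda>x. if x \<in> A then f' x else - g' x - c)"
  proof (rule noncrossing_glue[OF f'(1) ncg E(2) f'(3)])
    show "- g' x - c \<le> 0" if "x \<in> B" for x using g'(3)[OF that] by (simp add: c_def)
    show "f' x = 0 \<and> - g' x - c = 0" if "x \<in> A" "x \<in> B" for x
      using that a b f' g' assms(9) by (auto simp: c_def)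
    show "x = y" if xy: "x \<in> A" "y \<in> B" "f' x = 0" "- g' y - c = 0" for x y
    proof -
      have "c = 0" "g' y = 0" using g'(3)[OF xy(2)] xy by (auto simp: c_def split: if_splits)
      then have "x = a" "y = b" "A \<inter> B \<noteq> {}"
        using inj xy a b f' g' by (auto simp: inj_on_def c_def split: if_splits)
      then show ?thesis using a b assms(9) by blast
    qed
  qed
  then show ?thesis using that by blast
qed

text \<open>The hypothesis \<open>blocks\<close> speaks of all sets that induce a 2-connected graph,
  maximal or not. It therefore passes to subsets, as the induction requires.\<close>

lemma noncrossing_of_two_connected:
  assumes "finite V" "sym E"
    and blocks: "\<And>H. H \<subseteq> V \<Longrightarrow> 3 \<le> card H \<Longrightarrow> connected_on E H \<Longrightarrow>
      (\<And>v. v \<in> H \<Longrightarrow> connected_on E (H - {v})) \<Longrightarrow> \<exists>f. noncrossing H (E \<inter> H \<times> H) f"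
  shows "\<exists>f. noncrossing V (E \<inter> V \<times> V) f"
  using assms(1) blocks
proof (induction V rule: finite_psubset_induct)
  case (psubset W)
  let ?F = "E \<inter> W \<times> W"
  have sub: "?F \<inter> X \<times> X = E \<inter> X \<times> X" if "X \<subseteq> W" for X using that by blast
  have symF: "sym ?F" using assms(2) by (auto simp: sym_def)
  have glue: "\<exists>f. noncrossing W ?F f"
    if parts: "A \<subset> W" "B \<subset> W" "A \<union> B = W" "A \<noteq> {}" "B \<noteq> {}" "A \<inter> B \<subseteq> {v}" "?F \<subseteq> A \<times> A \<union> B \<times> B" for A B v
  proof -
    have part: "\<exists>f. noncrossing X (?F \<inter> X \<times> X) f" if X: "X \<subset> W" for X
    proof -
      have "\<exists>f. noncrossing X (E \<inter> X \<times> X) f"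
        by (rule psubset.IH[OF X]) (use psubset.prems X in auto)
      then show ?thesis using sub[of X] X by auto
    qed
    obtain f g where fg: "noncrossing A (?F \<inter> A \<times> A) f" "noncrossing B (?F \<inter> B \<times> B) g"
      using part[OF parts(1)] part[OF parts(2)] by blast
    have "finite A" "finite B" using parts psubset.hyps finite_subset by blast+
    then obtain h where "noncrossing (A \<union> B) ?F h"
      using noncrossing_glue_at[OF fg symF parts(7) _ _ parts(4-6)] by blast
    then show ?thesis using parts(3) by auto
  qed
  show ?case
  proof (cases "card W \<le> 2")
    case True
    obtain f :: "'a \<Rightarrow> nat" where f: "inj_on f W" using finite_imp_inj_to_nat_seg psubset.hyps by metis
    \<comment> \<open>An interleaving needs more than two vertices.\<close>
    have "False" if "(a, c) \<in> ?F" "(b, d) \<in> ?F" "f a < f b" "f b < f c" for a b c d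
    proof -
      have "a \<noteq> b" "b \<noteq> c" "a \<noteq> c" using that by auto
      then have "card {a, b, c} = 3" "{a, b, c} \<subseteq> W" using that by auto
      then show False using True card_mono[OF psubset.hyps, of "{a, b, c}"] by linarith
    qed
    then have "noncrossing W ?F (\<lambda>x. real (f x))"
      using f unfolding noncrossing_def inj_on_def of_nat_less_iff of_nat_eq_iff by fast
    then show ?thesis by blast
  next
    case False
    then have ne: "W \<noteq> {}" by auto
    show ?thesis
    proof (cases "connected_on E W")
      case False
      then obtain A where A: "A \<subseteq> W" "A \<noteq> {}" "A \<noteq> W" "E \<inter> A \<times> (W - A) = {}" "E \<inter> (W - A) \<times> A = {}"
        using not_connected_on_cut[OF assms(2) ne] by blast
      \<comment> \<open>The parts are disjoint, so any value serves as the common vertex.\<close>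
      show ?thesis by (rule glue[of A "W - A" undefined]) (use A in blast)+
    next
      case conn: True
      show ?thesis
      proof (cases "\<forall>v \<in> W. connected_on E (W - {v})")
        case True
        then show ?thesis using psubset.prems[of W] conn False by auto
      next
        case nv: False
        then obtain v where v: "v \<in> W" "\<not> connected_on E (W - {v})" by blast
        have "W - {v} \<noteq> {}"
          using False card_mono[of "{v}" W] by auto
        then obtain A where A: "A \<subseteq> W - {v}" "A \<noteq> {}" "A \<noteq> W - {v}"
          "E \<inter> A \<times> (W - {v} - A) = {}" "E \<inter> (W - {v} - A) \<times> A = {}"
          using not_connected_on_cut[OF assms(2) _ v(2)] by blast
        \<comment> \<open>Both parts contain the cut vertex \<open>v\<close>, and nothing else is
          common to them.\<close>
        show ?thesis by (rule glue[of "insert v A" "W - A" v]) (use A v in blast)+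
      qed
    qed
  qed
qed

section \<open>Connected sets in a noncrossing order, and the absence of K_4 minors\<close>

text \<open>\<open>Y\<close> avoids \<open>x\<close> and \<open>y\<close>, so an edge of
  \<open>Y\<close> that leaves the interval between them would interleave with the edge from
  \<open>x\<close> to \<open>y\<close>.\<close>

lemma noncrossing_connected_under_arc:
  assumes f: "noncrossing V E f" and E: "sym E" and "connected_on E Y" "Y \<subseteq> V"
    and xy: "(x, y) \<in> E" "x \<in> V" "y \<in> V" "x \<notin> Y" "y \<notin> Y"
    and b: "b \<in> Y" "f x < f b" "f b < f y" and d: "d \<in> Y"
  shows "f x < f d \<and> f d < f y"
proof (rule ccontr)
  assume *: "\<not> ?thesis"
  obtain p q where pq: "p \<in> Y" "f x < f p" "f p < f y" "q \<in> Y" "\<not> (f x < f q \<and> f q < f y)" "(p, q) \<in> E"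
    using connected_on_cut[OF assms(3) b(1) _ d, of "{z. f x < f z \<and> f z < f y}"] b * by blast
  have "f q \<noteq> f x" "f q \<noteq> f y"
    using noncrossing_injD[OF f, of q x] noncrossing_injD[OF f, of q y] pq xy assms(4) by blast+
  then have "f q < f x \<or> f y < f q" using pq by linarith
  then show False
    using noncrossingD[OF f, of x y p q] noncrossingD[OF f, of q p x y] pq xy symD[OF E] by blast
qed

text \<open>Some edge of \<open>X\<close> leaves the interval between \<open>b\<close> and
  \<open>d\<close>. It spans exactly one of \<open>b\<close> and \<open>d\<close>, while a connected
  \<open>Y\<close> under that edge would have to keep both there.\<close>

lemma noncrossing_connected_disjoint:
  assumes f: "noncrossing V E f" and E: "sym E"
    and X: "connected_on E X" "X \<subseteq> V" and Y: "connected_on E Y" "Y \<subseteq> V" and disj: "X \<inter> Y = {}"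
    and "a \<in> X" "c \<in> X" "b \<in> Y" "d \<in> Y" and lt: "f a < f b" "f b < f c" "f c < f d"
  shows False
proof -
  obtain x y where xy: "x \<in> X" "f b < f x" "f x < f d" "y \<in> X" "\<not> (f b < f y \<and> f y < f d)" "(x, y) \<in> E"
    using connected_on_cut[OF X(1), of c "{z. f b < f z \<and> f z < f d}" a] assms by auto
  have "f y \<noteq> f b" "f y \<noteq> f d"
    using noncrossing_injD[OF f, of y b] noncrossing_injD[OF f, of y d] xy assms by blast+
  then have "f y < f b \<or> f d < f y" using xy by linarith
  then show False
    using noncrossing_connected_under_arc[OF f E Y, of y x b d]
      noncrossing_connected_under_arc[OF f E Y, of x y d b] xy assms symD[OF E, of x y]
    by (auto simp: disjoint_iff subset_iff)
qed

text \<open>Choose a representative in each branch set and sort the four. The union of the first and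
  third branch sets and that of the second and fourth are connected and disjoint, yet they
  interleave.\<close>

lemma noncrossing_no_K4:
  fixes \<phi> :: "'b \<Rightarrow> 'a set"
  assumes f: "noncrossing V E f" and E: "sym E" and K: "card K = 4"
    and \<phi>: "\<And>x. x \<in> K \<Longrightarrow> \<phi> x \<subseteq> V \<and> connected_on E (\<phi> x)"
    and disj: "\<And>x y. x \<in> K \<Longrightarrow> y \<in> K \<Longrightarrow> x \<noteq> y \<Longrightarrow> \<phi> x \<inter> \<phi> y = {}"
    and adj: "\<And>x y. x \<in> K \<Longrightarrow> y \<in> K \<Longrightarrow> x \<noteq> y \<Longrightarrow> \<exists>u \<in> \<phi> x. \<exists>v \<in> \<phi> y. (u, v) \<in> E"
  shows False
proof -
  define r where "r x = (SOME u. u \<in> \<phi> x)" for x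
  have r: "r x \<in> \<phi> x" if "x \<in> K" for x
    using \<phi>[OF that] some_in_eq by (auto simp: r_def connected_on_def)
  have "inj_on (\<lambda>x. f (r x)) K"
  proof (rule inj_onI)
    fix x y assume xy: "x \<in> K" "y \<in> K" "f (r x) = f (r y)"
    then have "r x = r y"
      using noncrossing_injD[OF f, of "r x" "r y"] r[of x] r[of y] \<phi>[of x] \<phi>[of y] by blast
    then show "x = y" using xy r[of x] r[of y] disj[of x y] by auto
  qed
  then have "card ((\<lambda>x. f (r x)) ` K) = 4" using K by (simp add: card_image)
  then have "length (sorted_list_of_set ((\<lambda>x. f (r x)) ` K)) = 4" by simp
  then obtain s t u v where stuv: "sorted_list_of_set ((\<lambda>x. f (r x)) ` K) = [s, t, u, v]"
    by (simp only: numeral_eq_Suc length_Suc_conv length_0_conv pred_numeral_simps BitM.simps) blast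
  have "finite ((\<lambda>x. f (r x)) ` K)" using K by (metis card.infinite finite_imageI zero_neq_numeral)
  then have "sorted_wrt (<) [s, t, u, v]" "(\<lambda>x. f (r x)) ` K = {s, t, u, v}"
    using stuv strict_sorted_list_of_set set_sorted_list_of_set
    by (metis, metis list.simps(15) empty_set)
  then have "s < t" "t < u" "u < v" "{s, t, u, v} \<subseteq> (\<lambda>x. f (r x)) ` K" by auto
  then obtain a b c d where abcd: "a \<in> K" "b \<in> K" "c \<in> K" "d \<in> K"
    "f (r a) < f (r b)" "f (r b) < f (r c)" "f (r c) < f (r d)"
    by (simp only: insert_subset image_iff) blast
  have ne: "a \<noteq> b" "a \<noteq> c" "a \<noteq> d" "b \<noteq> c" "b \<noteq> d" "c \<noteq> d" using abcd by auto
  have un: "connected_on E (\<phi> x \<union> \<phi> y)" if "x \<in> K" "y \<in> K" "x \<noteq> y" for x y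
    using adj[OF that] \<phi> that connected_on_Un[OF E, of "\<phi> x" "\<phi> y"] by blast
  have "(\<phi> a \<union> \<phi> c) \<inter> (\<phi> b \<union> \<phi> d) = {}" using disj abcd ne by blast
  then show False
    using noncrossing_connected_disjoint[OF f E un[of a c] _ un[of b d], of "r a" "r c" "r b" "r d"]
      abcd ne r \<phi> by auto
qed

subsection \<open>Theta curves in the plane\<close>

definition theta :: "complex \<Rightarrow> complex \<Rightarrow> (real \<Rightarrow> complex) \<Rightarrow> (real \<Rightarrow> complex) \<Rightarrow> (real \<Rightarrow> complex) \<Rightarrow> bool" where
  "theta a b g1 g2 g3 \<longleftrightarrow> a \<noteq> b \<and>
     (\<forall>g \<in> {g1, g2, g3}. arc g \<and> pathstart g = a \<and> pathfinish g = b) \<and>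
     path_image g1 \<inter> path_image g2 = {a, b} \<and>
     path_image g1 \<inter> path_image g3 = {a, b} \<and>
     path_image g2 \<inter> path_image g3 = {a, b}"

lemma theta_perm:
  assumes "theta a b g1 g2 g3"
  shows "theta a b g2 g1 g3" "theta a b g1 g3 g2"
  using assms unfolding theta_def by blast+

text \<open>The Jordan curve theorem for \<open>g +++ reversepath h\<close>, phrased with the images
  of the two arcs.\<close>

lemma inside_two_arcs:
  fixes g h :: "real \<Rightarrow> complex"
  assumes "arc g" "arc h" "pathstart g = a" "pathfinish g = b" "pathstart h = a" "pathfinish h = b"
    and "path_image g \<inter> path_image h = {a, b}"
  shows "inside (path_image g \<union> path_image h) \<noteq> {}"
    and "open (inside (path_image g \<union> path_image h))"
    and "connected (inside (path_image g \<union> path_image h))"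
    and "frontier (inside (path_image g \<union> path_image h)) = path_image g \<union> path_image h"
proof -
  let ?c = "g +++ reversepath h"
  have "simple_path ?c"
    by (rule simple_path_join_loop) (use assms in \<open>auto simp: arc_reversepath\<close>)
  moreover have "pathfinish ?c = pathstart ?c" "path_image ?c = path_image g \<union> path_image h"
    using assms by (auto simp: path_image_join)
  ultimately show "inside (path_image g \<union> path_image h) \<noteq> {}"
    "open (inside (path_image g \<union> path_image h))"
    "connected (inside (path_image g \<union> path_image h))"
    "frontier (inside (path_image g \<union> path_image h)) = path_image g \<union> path_image h"
    using Jordan_inside_outside[of ?c] by auto
qed

text \<open>
  If \<open>p\<close> is separated from infinity neither by \<open>g1\<close> and \<open>g3\<close> nor by \<open>g2\<close> and \<open>g3\<close>, then, these
  two closed curves having the connected intersection \<open>g3\<close>, Janiszewski's theorem says that not even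
  their union separates it.
\<close>

lemma theta_inside_subset:
  assumes "theta a b g1 g2 g3"
  shows "inside (path_image g1 \<union> path_image g2) \<subseteq>
    inside (path_image g1 \<union> path_image g3) \<union> inside (path_image g2 \<union> path_image g3) \<union> path_image g3"
proof
  fix p assume p: "p \<in> inside (path_image g1 \<union> path_image g2)"
  let ?U = "path_image g1 \<union> path_image g3" and ?V = "path_image g2 \<union> path_image g3"
  show "p \<in> inside ?U \<union> inside ?V \<union> path_image g3"
  proof (rule ccontr)
    assume np: "\<not> ?thesis"
    have arcs: "arc g1" "arc g2" "arc g3" using assms by (auto simp: theta_def)
    then have comp: "compact (path_image g1)" "compact (path_image g2)" "compact (path_image g3)"
      by (auto intro: compact_path_image arc_imp_path)
    then have cUV: "compact ?U" "compact ?V" "compact (?U \<union> ?V)" by auto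
    \<comment> \<open>\<open>q\<close> stands for the point at infinity: a point is outside each of
      the curves considered once it can be joined to \<open>q\<close> off that curve.\<close>
    then obtain q where q: "q \<in> outside (?U \<union> ?V)"
      using outside_bounded_nonempty compact_imp_bounded by blast
    have p': "p \<notin> path_image g1" "p \<notin> path_image g2"
      using p inside_no_overlap by blast+
    have out: "p \<in> outside ?U" "p \<in> outside ?V"
      using np p' inside_outside[of ?U] inside_outside[of ?V] by blast+
    have qout: "q \<in> outside ?U" "q \<in> outside ?V"
      using q outside_mono[of ?U "?U \<union> ?V"] outside_mono[of ?V "?U \<union> ?V"] by auto
    have D: "2 \<le> DIM(complex)" by simp
    have "?U \<inter> ?V = path_image g3"
      using assms unfolding theta_def by auto
    then have "connected (?U \<inter> ?V)"
      using arcs by (metis connected_path_image arc_imp_path)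
    moreover have "connected_component (- ?U) p q" "connected_component (- ?V) p q"
      using out qout connected_outside[OF compact_imp_bounded[OF cUV(1)] D]
        connected_outside[OF compact_imp_bounded[OF cUV(2)] D]
      unfolding connected_component_def using outside_no_overlap by blast+
    ultimately have "connected_component (- (?U \<union> ?V)) p q"
      using cUV Janiszewski compact_imp_closed by blast
    then have "p \<in> outside (?U \<union> ?V)"
      using q by (meson connected_component_sym outside_same_component)
    then have "p \<in> outside (path_image g1 \<union> path_image g2)"
      using outside_mono[of "path_image g1 \<union> path_image g2" "?U \<union> ?V"] by auto
    then show False using p inside_Int_outside by blast
  qed
qed

text \<open>Neither set can leave the other without meeting its frontier, so each contains the
  other.\<close>

lemma connected_open_frontier_eq:
  fixes S T :: "complex set"
  assumes "connected S" "connected T" "S \<inter> T \<noteq> {}" "S \<inter> frontier T = {}" "T \<inter> frontier S = {}"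
  shows "S = T"
  using assms connected_Int_frontier[of S T] connected_Int_frontier[of T S] by blast

text \<open>Otherwise the inside of \<open>g1\<close> and \<open>g2\<close> avoids
  \<open>g3\<close>, hence by \<open>theta_inside_subset\<close> meets the inside of another pair.
  Neither of these insides meets the frontier of the other, so they coincide; then so do their
  frontiers, although each of these contains an arc that the other lacks.\<close>

lemma theta_enters:
  assumes th: "theta a b g1 g2 g3"
  shows "path_image g1 \<inter> inside (path_image g2 \<union> path_image g3) \<noteq> {} \<or>
    path_image g2 \<inter> inside (path_image g1 \<union> path_image g3) \<noteq> {} \<or>
    path_image g3 \<inter> inside (path_image g1 \<union> path_image g2) \<noteq> {}"
proof (rule ccontr)
  assume *: "\<not> ?thesis"
  let ?P1 = "path_image g1" and ?P2 = "path_image g2" and ?P3 = "path_image g3"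
  have arcs: "arc g1" "arc g2" "arc g3" and ends: "pathstart g1 = a" "pathfinish g1 = b"
    "pathstart g2 = a" "pathfinish g2 = b" "pathstart g3 = a" "pathfinish g3 = b"
    and int: "?P1 \<inter> ?P2 = {a, b}" "?P1 \<inter> ?P3 = {a, b}" "?P2 \<inter> ?P3 = {a, b}"
    using th by (auto simp: theta_def)
  note i12 = inside_two_arcs[OF arcs(1) arcs(2) ends(1) ends(2) ends(3) ends(4) int(1)]
  note i13 = inside_two_arcs[OF arcs(1) arcs(3) ends(1) ends(2) ends(5) ends(6) int(2)]
  note i23 = inside_two_arcs[OF arcs(2) arcs(3) ends(3) ends(4) ends(5) ends(6) int(3)]
  have ne: "\<exists>x. x \<in> path_image g \<and> x \<noteq> a \<and> x \<noteq> b" if "g \<in> {g1, g2, g3}" for g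
  proof -
    have "simple_path g" "pathstart g = a" "pathfinish g = b"
      using that arcs ends by (auto intro: arc_imp_simple_path)
    then show ?thesis using nonempty_simple_path_endless[of g] by auto
  qed
  have "?P1 \<union> ?P2 \<noteq> ?P1 \<union> ?P3" using ne[of g2] int by blast
  moreover have "?P1 \<union> ?P2 \<noteq> ?P2 \<union> ?P3" using ne[of g1] int by blast
  moreover obtain p where p: "p \<in> inside (?P1 \<union> ?P2)" using i12 by blast
  moreover have "p \<notin> ?P3" using * p by blast
  ultimately show False
    using theta_inside_subset[OF th]
      connected_open_frontier_eq[OF i12(3) i13(3)] connected_open_frontier_eq[OF i12(3) i23(3)]
      i12(4) i13(4) i23(4) * inside_no_overlap
    by (smt (verit) Int_Un_distrib Int_commute Un_iff disjoint_iff subset_iff)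
qed

text \<open>Without its ends the third arc is connected and misses the frontier of the inside, so it
  cannot leave once it has entered.\<close>

lemma endless_arc_inside:
  assumes th: "theta a b g1 g2 g3"
    and "path_image g3 \<inter> inside (path_image g1 \<union> path_image g2) \<noteq> {}"
  shows "path_image g3 - {a, b} \<subseteq> inside (path_image g1 \<union> path_image g2)"
proof -
  let ?I = "inside (path_image g1 \<union> path_image g2)" and ?c = "path_image g3 - {a, b}"
  have "connected ?c"
    using connected_simple_path_endless[of g3] th by (auto simp: theta_def arc_imp_simple_path)
  moreover have "frontier ?I = path_image g1 \<union> path_image g2"
    using th by (intro inside_two_arcs) (auto simp: theta_def)
  moreover have "?c \<inter> (path_image g1 \<union> path_image g2) = {}"
    using th by (auto simp: theta_def)
  moreover have "{a, b} \<subseteq> path_image g1"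
    using th by (auto simp: theta_def)
  then have "?c \<inter> ?I \<noteq> {}"
    using assms(2) inside_no_overlap[of "path_image g1 \<union> path_image g2"] by blast
  ultimately show ?thesis
    using connected_Int_frontier[of ?c ?I] by blast
qed

text \<open>The inside of \<open>S\<close> is open and disjoint from the outside of the larger set
  \<open>D\<close>, hence also from the closure of that outside. This is how the outer position of a
  vertex is used.\<close>

lemma not_inside_if_frontier_outside:
  assumes "closed S" "S \<subseteq> D" "q \<in> frontier (outside D)"
  shows "q \<notin> inside (S :: complex set)"
proof
  assume "q \<in> inside S"
  moreover have "open (inside S)" using assms by (simp add: open_inside)
  moreover have "q \<in> closure (outside D)" using assms by (simp add: frontier_def)
  ultimately have "inside S \<inter> outside D \<noteq> {}" by (metis disjoint_iff open_Int_closure_eq_empty)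
  then show False using outside_mono[OF assms(2)] inside_Int_outside by blast
qed

text \<open>The outer points \<open>q1\<close> and \<open>q2\<close> keep \<open>g1\<close> and
  \<open>g2\<close> from being the arc that enters, which leaves only \<open>g3\<close> in
  \<open>theta_enters\<close>.\<close>

lemma theta_third_inside:
  assumes th: "theta a b g1 g2 g3"
    and "path_image g1 \<subseteq> D" "path_image g2 \<subseteq> D" "path_image g3 \<subseteq> D"
    and "q1 \<in> path_image g1 - {a, b}" "q1 \<in> frontier (outside D)"
    and "q2 \<in> path_image g2 - {a, b}" "q2 \<in> frontier (outside D)"
  shows "path_image g3 - {a, b} \<subseteq> inside (path_image g1 \<union> path_image g2)"
proof -
  have cl: "closed (path_image g1)" "closed (path_image g2)" "closed (path_image g3)"
    using th by (auto simp: theta_def closed_arc_image)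
  have "path_image g1 \<inter> inside (path_image g2 \<union> path_image g3) = {}"
    using endless_arc_inside[of a b g2 g3 g1] theta_perm[OF th] theta_perm[OF theta_perm(1)[OF th]]
      not_inside_if_frontier_outside[of "path_image g2 \<union> path_image g3" D q1] cl assms by blast
  moreover have "path_image g2 \<inter> inside (path_image g1 \<union> path_image g3) = {}"
    using endless_arc_inside[of a b g1 g3 g2] theta_perm[OF th]
      not_inside_if_frontier_outside[of "path_image g1 \<union> path_image g3" D q2] cl assms by blast
  ultimately show ?thesis
    using theta_enters[OF th] endless_arc_inside[OF th] by blast
qed

lemma no_theta_on_outer_face:
  assumes th: "theta a b g1 g2 g3"
    and "path_image g1 \<subseteq> D" "path_image g2 \<subseteq> D" "path_image g3 \<subseteq> D"
    and "q1 \<in> path_image g1 - {a, b}" "q1 \<in> frontier (outside D)"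
    and "q2 \<in> path_image g2 - {a, b}" "q2 \<in> frontier (outside D)"
    and "q3 \<in> path_image g3 - {a, b}" "q3 \<in> frontier (outside D)"
  shows False
proof -
  have "closed (path_image g1 \<union> path_image g2)"
    using th by (auto simp: theta_def closed_arc_image)
  then show False
    using theta_third_inside[OF assms(1-8)] not_inside_if_frontier_outside[of _ D q3] assms by blast
qed

text \<open>Needed to carry the location of an open arc over to its ends, by continuity at 0 and
  1.\<close>

lemma ends_in_closure_endless:
  assumes "simple_path g"
  shows "path_image g \<subseteq> closure (path_image g - {pathstart g, pathfinish g})"
proof -
  have "continuous_on (closure {0<..<1}) g"
    using assms by (simp add: simple_path_def path_def)
  then have "g ` closure {0<..<1} \<subseteq> closure (g ` {0<..<1})"
    by (intro image_closure_subset) (auto simp: closure_subset)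
  then show ?thesis
    using simple_path_endless[OF assms] by (simp add: path_image_def)
qed

text \<open>The chord \<open>g3\<close> divides the inside of the cycle into the insides of its two
  halves, and the open chord \<open>h3\<close> lies inside the cycle. If \<open>h3\<close> met one
  half, it would stay in it, and its end off that half's boundary would be inside too, although it
  is an outer point.\<close>

lemma no_crossing_chords_on_outer_face:
  assumes th: "theta a b g1 g2 g3" and th': "theta c d h1 h2 h3"
    and img: "path_image h1 \<union> path_image h2 = path_image g1 \<union> path_image g2"
    and D: "path_image g1 \<subseteq> D" "path_image g2 \<subseteq> D" "path_image g3 \<subseteq> D" "path_image h3 \<subseteq> D"
    and c: "c \<in> path_image g1 - {a, b}" "c \<in> frontier (outside D)"
    and d: "d \<in> path_image g2 - {a, b}" "d \<in> frontier (outside D)"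
    and a: "a \<in> path_image h1 - {c, d}" "a \<in> frontier (outside D)"
    and b: "b \<in> path_image h2 - {c, d}" "b \<in> frontier (outside D)"
    and disj: "path_image g3 \<inter> path_image h3 = {}"
  shows False
proof -
  let ?c = "path_image h3 - {c, d}"
  have sp: "simple_path h3" and ends: "pathstart h3 = c" "pathfinish h3 = d"
    using th' by (auto simp: theta_def arc_imp_simple_path)
  have conn: "connected ?c" and cls: "path_image h3 \<subseteq> closure ?c"
    using connected_simple_path_endless[OF sp] ends_in_closure_endless[OF sp] ends by auto
  have ne: "?c \<noteq> {}" using nonempty_simple_path_endless[OF sp] ends by auto
  have cd: "c \<in> path_image h3" "d \<in> path_image h3"
    using th' by (auto simp: theta_def)
  have int: "path_image g1 \<inter> path_image g2 = {a, b}" using th by (auto simp: theta_def)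
  have ins: "?c \<subseteq> inside (path_image g1 \<union> path_image g2)"
    using theta_third_inside[OF th', of D a b] img D a b by auto
  then have clear: "?c \<inter> (path_image g1 \<union> path_image g2) = {}"
    using inside_no_overlap by blast
  \<comment> \<open>\<open>q\<close> is the end of \<open>h3\<close> on the other side of the cycle:
    \<open>d\<close> for \<open>g1\<close> and \<open>c\<close> for \<open>g2\<close>.\<close>
  have avoid: "?c \<inter> inside (path_image g \<union> path_image g3) = {}"
    if g: "g \<in> {g1, g2}" and q: "q \<in> {c, d}" "q \<notin> path_image g" for g q
  proof (rule ccontr)
    let ?I = "inside (path_image g \<union> path_image g3)"
    assume meets: "\<not> ?thesis"
    have cl: "closed (path_image g \<union> path_image g3)"
      using th g by (auto simp: theta_def closed_arc_image)
    have fr: "frontier ?I = path_image g \<union> path_image g3"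
      using th g by (intro inside_two_arcs(4)) (auto simp: theta_def)
    then have "?c \<inter> frontier ?I = {}" using clear disj g by auto
    then have "?c \<subseteq> ?I"
      using connected_Int_frontier[OF conn, of ?I] meets by blast
    then have "q \<in> closure ?I" using cls cd q closure_mono by blast
    then have "q \<in> ?I \<union> frontier ?I"
      using closure_Un_frontier by blast
    then have "q \<in> ?I" using fr q cd disj by blast
    then show False
      using not_inside_if_frontier_outside[OF cl, of D q] g q c d D by blast
  qed
  have "d \<notin> path_image g1" "c \<notin> path_image g2" using int c d by auto
  then have "?c \<inter> inside (path_image g1 \<union> path_image g3) = {}"
    "?c \<inter> inside (path_image g2 \<union> path_image g3) = {}"
    using avoid by blast+
  then show False
    using theta_inside_subset[OF th] ins ne disj by blast
qed

subsection \<open>Straight-line drawings on a circle\<close>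

text \<open>The rational parametrization of the unit circle, with \<open>t\<close> the tangent of
  half the angle. It carries the order of the line to the order along the circle, and makes
  incidence with chords polynomial.\<close>

definition circle_point :: "real \<Rightarrow> complex" where
  "circle_point t = Complex ((1 - t\<^sup>2) / (1 + t\<^sup>2)) (2 * t / (1 + t\<^sup>2))"

text \<open>
  The zero set of \<open>chord_side a b\<close> is the line through the points with parameters \<open>a\<close> and \<open>b\<close>, because
  of the factorization in \<open>chord_side_circle_point\<close>.
\<close>

definition chord_side :: "real \<Rightarrow> real \<Rightarrow> complex \<Rightarrow> real" where
  "chord_side a b z = (1 - a * b) * Re z + (a + b) * Im z - (1 + a * b)"

lemma one_plus_square_pos: "0 < 1 + (t::real)\<^sup>2"
  by (simp add: add_pos_nonneg)

lemma chord_side_circle_point: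
  "chord_side a b (circle_point t) = - (2 / (1 + t\<^sup>2)) * ((t - a) * (t - b))"
proof -
  define d where "d = 1 + t\<^sup>2"
  have "d \<noteq> 0" using one_plus_square_pos[of t] by (simp add: d_def)
  have "chord_side a b (circle_point t) = (1 - a * b) * ((1 - t\<^sup>2) / d) + (a + b) * (2 * t / d) - (1 + a * b)"
    by (simp add: chord_side_def circle_point_def d_def)
  also have "\<dots> = ((1 - a * b) * (1 - t\<^sup>2) + (a + b) * (2 * t) - (1 + a * b) * d) / d"
    using \<open>d \<noteq> 0\<close> by (simp add: divide_simps)
  also have "(1 - a * b) * (1 - t\<^sup>2) + (a + b) * (2 * t) - (1 + a * b) * d = - 2 * ((t - a) * (t - b))"
    by (simp add: d_def algebra_simps power2_eq_square)
  finally show ?thesis by (simp add: d_def)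
qed

lemma chord_side_segment:
  "chord_side a b ((1 - u) *\<^sub>R p + u *\<^sub>R q) = (1 - u) * chord_side a b p + u * chord_side a b q"
  by (simp add: chord_side_def algebra_simps)

lemma circle_point_sphere: "circle_point t \<in> sphere 0 1"
proof -
  have "(1 - t\<^sup>2)\<^sup>2 + (2 * t)\<^sup>2 = (1 + t\<^sup>2)\<^sup>2" by (simp add: power2_eq_square algebra_simps)
  then have "((1 - t\<^sup>2) / (1 + t\<^sup>2))\<^sup>2 + (2 * t / (1 + t\<^sup>2))\<^sup>2 = 1"
    using one_plus_square_pos[of t] by (simp add: power_divide flip: add_divide_distrib)
  then show ?thesis by (simp add: circle_point_def cmod_def)
qed

lemma chord_meets_circle_point:
  assumes "circle_point t \<in> closed_segment (circle_point a) (circle_point b)"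
  shows "t = a \<or> t = b"
proof -
  obtain u where "circle_point t = (1 - u) *\<^sub>R circle_point a + u *\<^sub>R circle_point b"
    using assms by (auto simp: in_segment)
  then have "chord_side a b (circle_point t) = 0"
    by (simp add: chord_side_segment chord_side_circle_point)
  then show ?thesis using one_plus_square_pos[of t] by (simp add: chord_side_circle_point)
qed

lemma inj_circle_point: "inj circle_point"
  by (rule injI) (metis chord_meets_circle_point ends_in_segment(1))

text \<open>If the ends do not interleave, \<open>c\<close> and \<open>d\<close> lie weakly on the
  same side of the line through \<open>a\<close> and \<open>b\<close>. A common point is a proper
  convex combination of the two on that line, so both lie on it and the chords coincide.\<close>

lemma chords_disjoint:
  assumes lt: "a < b" "c < d" and ne: "\<not> (a = c \<and> b = d)"
    and "\<not> (a < c \<and> c < b \<and> b < d)" "\<not> (c < a \<and> a < d \<and> d < b)"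
  shows "open_segment (circle_point a) (circle_point b) \<inter>
    open_segment (circle_point c) (circle_point d) = {}"
proof (rule ccontr)
  assume "\<not> ?thesis"
  then obtain z where z: "z \<in> open_segment (circle_point a) (circle_point b)"
    "z \<in> open_segment (circle_point c) (circle_point d)" by blast
  obtain u where "z = (1 - u) *\<^sub>R circle_point a + u *\<^sub>R circle_point b"
    using z(1) by (auto simp: in_segment)
  then have z0: "chord_side a b z = 0"
    by (simp add: chord_side_segment chord_side_circle_point)
  obtain w where w: "0 < w" "w < 1" "z = (1 - w) *\<^sub>R circle_point c + w *\<^sub>R circle_point d"
    using z(2) by (auto simp: in_segment)
  \<comment> \<open>Up to the negative factors \<open>- p\<close> and \<open>- q\<close>, these are
    the sides of \<open>c\<close> and \<open>d\<close> by
    \<open>chord_side_circle_point\<close>.\<close>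
  define s t where "s = (c - a) * (c - b)" and "t = (d - a) * (d - b)"
  define p q where "p = 2 / (1 + c\<^sup>2)" and "q = 2 / (1 + d\<^sup>2)"
  define k l where "k = (1 - w) * p" and "l = w * q"
  have kl: "0 < k" "0 < l"
    using w one_plus_square_pos[of c] one_plus_square_pos[of d] by (auto simp: k_def l_def p_def q_def)
  have "chord_side a b z = (1 - w) * (- p * s) + w * (- q * t)"
    unfolding w(3) chord_side_segment chord_side_circle_point s_def t_def p_def q_def ..
  also have "\<dots> = - (k * s + l * t)" by (simp add: k_def l_def)
  finally have eq: "k * s + l * t = 0" using z0 by simp
  have "s \<le> 0 \<and> t \<le> 0 \<or> 0 \<le> s \<and> 0 \<le> t"
    using assms unfolding s_def t_def mult_le_0_iff zero_le_mult_iff by linarith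
  then have "s = 0 \<and> t = 0"
  proof
    assume *: "s \<le> 0 \<and> t \<le> 0"
    then have "k * s \<le> 0" "l * t \<le> 0" using kl by (auto simp: mult_le_0_iff)
    then have "k * s = 0" "l * t = 0" using eq by linarith+
    then show ?thesis using kl by simp
  next
    assume *: "0 \<le> s \<and> 0 \<le> t"
    then have "0 \<le> k * s" "0 \<le> l * t" using kl by auto
    then have "k * s = 0" "l * t = 0" using eq by linarith+
    then show ?thesis using kl by simp
  qed
  then show False using lt ne by (auto simp: s_def t_def)
qed

text \<open>This one drawing is the witness both for \<open>outerplanar\<close> and, block by block,
  for \<open>pseudo_outerplanar\<close>.\<close>

lemma noncrossing_circle_drawing:
  assumes G: "pair_graph G" and f: "noncrossing (pverts G) (parcs G) f"
  shows "\<exists>pos \<gamma>. is_drawing G pos \<gamma> \<and> (\<forall>e \<in> uedges G. \<forall>e' \<in> uedges G. \<not> crossing pos \<gamma> e e') \<and>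
    pos ` pverts G \<subseteq> sphere 0 1 \<and> (\<forall>e \<in> uedges G. path_image (\<gamma> e) \<subseteq> cball 0 1)"
proof -
  interpret pg: pair_graph G by fact
  define pos where "pos v = circle_point (f v)" for v
  \<comment> \<open>An edge is a set without a first end; \<open>Min\<close> and \<open>Max\<close>
    fix a direction for its chord.\<close>
  define \<gamma> where "\<gamma> e = linepath (circle_point (Min (f ` e))) (circle_point (Max (f ` e)))" for e
  have inj_f: "inj_on f (pverts G)" using f by (simp add: noncrossing_def)
  have inj: "inj_on pos (pverts G)"
    using inj_f inj_circle_point by (auto simp: inj_on_def pos_def)
  have edge: "\<exists>u v. e = {u, v} \<and> (u, v) \<in> parcs G \<and> (v, u) \<in> parcs G \<and> u \<in> pverts G \<and> v \<in> pverts G \<and>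
      f u < f v \<and> pos u \<noteq> pos v \<and> \<gamma> e = linepath (pos u) (pos v)" if e: "e \<in> uedges G" for e
  proof -
    obtain x y where xy: "e = {x, y}" "(x, y) \<in> parcs G" using e by (auto simp: uedges_def)
    have yx: "(y, x) \<in> parcs G" using xy pg.pair_sym_arcs by (auto simp: symmetric_def dest: symD)
    have V: "x \<in> pverts G" "y \<in> pverts G" "x \<noteq> y" using xy pg.wellformed' pg.pair_no_loops by fastforce+
    then have "f x \<noteq> f y" "pos x \<noteq> pos y" using inj_f inj by (auto dest: inj_onD)
    then consider "f x < f y" | "f y < f x" by linarith
    then show ?thesis
    proof cases
      case 1
      then have "\<gamma> e = linepath (pos x) (pos y)" by (simp add: \<gamma>_def pos_def xy)
      moreover have "e = {x, y}" using xy by auto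
      ultimately show ?thesis using 1 xy yx V \<open>pos x \<noteq> pos y\<close> by metis
    next
      case 2
      then have "\<gamma> e = linepath (pos y) (pos x)" by (simp add: \<gamma>_def pos_def xy)
      moreover have "e = {y, x}" using xy by auto
      ultimately show ?thesis using 2 xy yx V \<open>pos x \<noteq> pos y\<close> by metis
    qed
  qed
  have "is_drawing G pos \<gamma>"
    unfolding is_drawing_def
  proof (intro conjI ballI inj)
    fix e assume "e \<in> uedges G"
    then obtain u v where e: "e = {u, v}" "u \<in> pverts G" "v \<in> pverts G" "pos u \<noteq> pos v"
      "\<gamma> e = linepath (pos u) (pos v)" using edge by blast
    show "arc (\<gamma> e)" "{pathstart (\<gamma> e), pathfinish (\<gamma> e)} = pos ` e" using e by auto
    have "pos w \<in> pos ` e" if "w \<in> pverts G" "pos w \<in> path_image (\<gamma> e)" for w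
    proof -
      have "f w = f u \<or> f w = f v"
        using that e chord_meets_circle_point[of "f w" "f u" "f v"] by (simp add: pos_def)
      then show ?thesis using that e inj_f by (auto dest: inj_onD)
    qed
    then show "path_image (\<gamma> e) \<inter> pos ` pverts G = pos ` e" using e by auto
  qed
  moreover have "\<not> crossing pos \<gamma> e e'" if ee: "e \<in> uedges G" "e' \<in> uedges G" for e e'
  proof
    assume cr: "crossing pos \<gamma> e e'"
    obtain u v where e: "e = {u, v}" "(u, v) \<in> parcs G" "f u < f v" "pos u \<noteq> pos v"
      "\<gamma> e = linepath (pos u) (pos v)" "u \<in> pverts G" "v \<in> pverts G" using edge[OF ee(1)] by blast
    obtain x y where e': "e' = {x, y}" "(x, y) \<in> parcs G" "f x < f y" "pos x \<noteq> pos y"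
      "\<gamma> e' = linepath (pos x) (pos y)" "x \<in> pverts G" "y \<in> pverts G" using edge[OF ee(2)] by blast
    have "\<not> (f u = f x \<and> f v = f y)" using cr e e' inj_f by (auto simp: crossing_def dest: inj_onD)
    then have "open_segment (pos u) (pos v) \<inter> open_segment (pos x) (pos y) = {}"
      unfolding pos_def using e e' noncrossingD[OF f e(2) e'(2)] noncrossingD[OF f e'(2) e(2)]
      by (intro chords_disjoint) auto
    then show False using cr e e' by (auto simp: crossing_def open_segment_def)
  qed
  moreover have "pos ` pverts G \<subseteq> sphere 0 1" using circle_point_sphere by (auto simp: pos_def)
  moreover have "path_image (\<gamma> e) \<subseteq> cball 0 1" for e
    unfolding \<gamma>_def path_image_linepath
    by (intro closed_segment_subset) (use circle_point_sphere sphere_cball in auto)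
  ultimately show ?thesis by blast
qed

text \<open>The complement of the disk lies in the outside of the drawing, so the circle lies in the
  closure of that outside; the vertices belong to the drawing, so they are on the frontier.\<close>

lemma noncrossing_imp_outerplanar:
  assumes "pair_graph G" "noncrossing (pverts G) (parcs G) f"
  shows "outerplanar G"
proof -
  obtain pos \<gamma> where d: "is_drawing G pos \<gamma>"
    "\<forall>e \<in> uedges G. \<forall>e' \<in> uedges G. \<not> crossing pos \<gamma> e e'"
    "pos ` pverts G \<subseteq> sphere 0 1" "\<forall>e \<in> uedges G. path_image (\<gamma> e) \<subseteq> cball 0 1"
    using noncrossing_circle_drawing[OF assms] by blast
  let ?D = "drawing_image G pos \<gamma>"
  have "?D \<subseteq> cball 0 1" using d sphere_cball[of 0 1] by (auto simp: drawing_image_def)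
  then have "- cball 0 1 \<subseteq> outside ?D" using outside_mono[of ?D "cball 0 1"] outside_convex[of "cball 0 1"] by auto
  then have "sphere 0 1 \<subseteq> closure (outside ?D)"
    using closure_mono[of "- cball 0 1" "outside ?D"] frontier_cball[of "0::complex" 1]
    by (auto simp: frontier_closures)
  moreover have "?D \<inter> outside ?D = {}" using outside_no_overlap by blast
  ultimately have "pos ` pverts G \<subseteq> frontier (outside ?D)"
    using d(3) interior_subset[of "outside ?D"] by (auto simp: frontier_def drawing_image_def)
  then show ?thesis using d unfolding outerplanar_def by blast
qed

subsection \<open>Outerplane drawings\<close>

fun walk_edges :: "'a list \<Rightarrow> 'a set set" where
  "walk_edges (x # y # zs) = insert {x, y} (walk_edges (y # zs))"
| "walk_edges _ = {}"

lemma walk_edges_append: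
  "xs \<noteq> [] \<Longrightarrow> ys \<noteq> [] \<Longrightarrow>
    walk_edges (xs @ ys) = walk_edges xs \<union> {{last xs, hd ys}} \<union> walk_edges ys"
proof (induction xs rule: walk_edges.induct)
  case ("2_2" v)
  then show ?case by (cases ys) auto
qed auto

lemma walk_edges_rev: "walk_edges (rev xs) = walk_edges xs"
proof (induction xs rule: walk_edges.induct)
  case (1 x y zs)
  then show ?case using walk_edges_append[of "rev (y # zs)" "[x]"] by (simp add: insert_commute)
qed auto

lemma walk_edges_subset: "e \<in> walk_edges xs \<Longrightarrow> e \<subseteq> set xs"
  by (induction xs rule: walk_edges.induct) auto

lemma in_Union_walk_edges: "2 \<le> length xs \<Longrightarrow> \<Union> (walk_edges xs) = set xs"
proof (induction xs rule: walk_edges.induct)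
  case (1 x y zs)
  then show ?case by (cases zs) auto
qed auto

text \<open>Keeps two of the paths of a theta from sharing the edge between their common
  ends.\<close>

lemma walk_edges_ends:
  assumes "distinct (a # P @ [b])" "P \<noteq> []"
  shows "{a, b} \<notin> walk_edges (a # P @ [b])"
proof -
  obtain p P' where "P = p # P'" using assms by (cases P) auto
  then show ?thesis using assms walk_edges_subset[of "{a, b}" "P @ [b]"]
    by (auto simp: doubleton_eq_iff)
qed

locale outerplane =
  fixes G :: "'a pair_pre_digraph" and pos :: "'a \<Rightarrow> complex" and \<gamma> :: "'a set \<Rightarrow> real \<Rightarrow> complex"
  assumes graph: "pair_graph G" and drawing: "is_drawing G pos \<gamma>"
    and plane: "e \<in> uedges G \<Longrightarrow> e' \<in> uedges G \<Longrightarrow> \<not> crossing pos \<gamma> e e'"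
    and outer: "pos ` pverts G \<subseteq> frontier (outside (drawing_image G pos \<gamma>))"
begin

sublocale pg: pair_graph G by (rule graph)

definition "edges_image F = (\<Union>e \<in> F. path_image (\<gamma> e))"

lemma uedge_verts: "e \<in> uedges G \<Longrightarrow> e \<subseteq> pverts G"
  by (auto simp: uedges_def dest: pg.wellformed')

lemma walk_verts: "walk (parcs G) xs \<Longrightarrow> 2 \<le> length xs \<Longrightarrow> set xs \<subseteq> pverts G"
proof (induction xs rule: walk_edges.induct)
  case (1 x y zs)
  then show ?case by (cases zs) (auto dest: pg.wellformed')
qed auto

lemma walk_edges_uedges: "walk (parcs G) xs \<Longrightarrow> walk_edges xs \<subseteq> uedges G"
  by (induction xs rule: walk_edges.induct) (auto simp: uedges_def)

text \<open>Without crossings a common point is an end of one of the edges. Being the position of a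
  vertex, it is an end of the other too, since no edge passes through a foreign vertex.\<close>

lemma edge_inter:
  assumes "e \<in> uedges G" "e' \<in> uedges G" "e \<noteq> e'"
  shows "path_image (\<gamma> e) \<inter> path_image (\<gamma> e') \<subseteq> pos ` (e \<inter> e')"
proof
  fix z assume z: "z \<in> path_image (\<gamma> e) \<inter> path_image (\<gamma> e')"
  have sub: "e \<subseteq> pverts G" "e' \<subseteq> pverts G" using assms uedge_verts by auto
  have "z \<in> pos ` e \<or> z \<in> pos ` e'"
    using plane[OF assms(1,2)] assms(3) z by (auto simp: crossing_def)
  then have "z \<in> pos ` pverts G" using sub by blast
  then have "z \<in> pos ` e" "z \<in> pos ` e'"
    using z drawing assms(1,2) unfolding is_drawing_def by blast+
  then show "z \<in> pos ` (e \<inter> e')"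
    using drawing sub unfolding is_drawing_def by (auto simp: inj_on_image_Int[of pos "pverts G"])
qed

lemma edges_image_inter:
  assumes "F \<subseteq> uedges G" "F' \<subseteq> uedges G" "F \<inter> F' = {}"
  shows "edges_image F \<inter> edges_image F' \<subseteq> pos ` (\<Union>F \<inter> \<Union>F')"
proof
  fix z assume "z \<in> edges_image F \<inter> edges_image F'"
  then obtain e e' where "e \<in> F" "e' \<in> F'" "z \<in> path_image (\<gamma> e) \<inter> path_image (\<gamma> e')"
    by (auto simp: edges_image_def)
  then show "z \<in> pos ` (\<Union>F \<inter> \<Union>F')" using edge_inter[of e e'] assms by blast
qed

lemma vertex_in_edges_image:
  assumes "F \<subseteq> uedges G" "v \<in> pverts G"
  shows "pos v \<in> edges_image F \<longleftrightarrow> v \<in> \<Union>F"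
proof -
  have "pos v \<in> path_image (\<gamma> e) \<longleftrightarrow> v \<in> e" if "e \<in> F" for e
  proof -
    have "path_image (\<gamma> e) \<inter> pos ` pverts G = pos ` e" "inj_on pos (pverts G)" "e \<subseteq> pverts G"
      using that assms drawing uedge_verts unfolding is_drawing_def by blast+
    then show ?thesis using assms(2) by (metis Int_iff imageI inj_on_image_mem_iff)
  qed
  then show ?thesis by (auto simp: edges_image_def)
qed

text \<open>The curve of an edge may run in either direction and is reversed if necessary.\<close>

lemma edge_arc:
  assumes "(x, y) \<in> parcs G"
  obtains g where "arc g" "pathstart g = pos x" "pathfinish g = pos y" "path_image g = path_image (\<gamma> {x, y})"
proof -
  have "{x, y} \<in> uedges G" using assms by (auto simp: uedges_def)
  then have g: "arc (\<gamma> {x, y})" "{pathstart (\<gamma> {x, y}), pathfinish (\<gamma> {x, y})} = {pos x, pos y}"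
    using drawing unfolding is_drawing_def by auto
  then consider "pathstart (\<gamma> {x, y}) = pos x" "pathfinish (\<gamma> {x, y}) = pos y"
    | "pathstart (\<gamma> {x, y}) = pos y" "pathfinish (\<gamma> {x, y}) = pos x"
    by (auto simp: doubleton_eq_iff)
  then show ?thesis
  proof cases
    case 1 then show ?thesis using that[of "\<gamma> {x, y}"] g by blast
  next
    case 2 then show ?thesis using that[of "reversepath (\<gamma> {x, y})"] g by (simp add: arc_reversepath)
  qed
qed

lemma walk_arc:
  assumes "walk (parcs G) xs" "distinct xs" "2 \<le> length xs"
  shows "\<exists>g. arc g \<and> pathstart g = pos (hd xs) \<and> pathfinish g = pos (last xs) \<and>
    path_image g = edges_image (walk_edges xs)"
  using assms
proof (induction xs rule: walk_edges.induct)
  case (1 x y zs)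
  obtain g where g: "arc g" "pathstart g = pos x" "pathfinish g = pos y"
    "path_image g = path_image (\<gamma> {x, y})" using edge_arc[of x y] 1 by auto
  show ?case
  proof (cases "zs = []")
    case True
    then show ?thesis using g by (auto simp: edges_image_def)
  next
    case False
    then have "2 \<le> length (y # zs)" by (cases zs) auto
    then obtain h where h: "arc h" "pathstart h = pos y" "pathfinish h = pos (last zs)"
      "path_image h = edges_image (walk_edges (y # zs))" using 1 False by auto
    \<comment> \<open>The first edge can meet the rest of the walk only at \<open>y\<close>, which
      is the condition for joining the arcs.\<close>
    have "x \<notin> \<Union> (walk_edges (y # zs))"
      using 1 in_Union_walk_edges[OF \<open>2 \<le> length (y # zs)\<close>] by auto
    moreover have "{{x, y}} \<subseteq> uedges G" "walk_edges (y # zs) \<subseteq> uedges G"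
      using walk_edges_uedges[OF 1(2)] by auto
    ultimately have "edges_image {{x, y}} \<inter> edges_image (walk_edges (y # zs)) \<subseteq> pos ` ({x, y} - {x})"
      using edges_image_inter[of "{{x, y}}" "walk_edges (y # zs)"] by fastforce
    then have "path_image g \<inter> path_image h \<subseteq> {pathstart h}"
      using g h by (auto simp: edges_image_def)
    then have "arc (g +++ h)" using g h by (intro arc_join) auto
    moreover have "path_image (g +++ h) = edges_image (walk_edges (x # y # zs))"
      using g h by (simp add: path_image_join) (simp add: edges_image_def)
    ultimately show ?thesis using g h False by (intro exI[of _ "g +++ h"]) auto
  qed
qed auto

lemma edges_image_subset: "F \<subseteq> uedges G \<Longrightarrow> edges_image F \<subseteq> drawing_image G pos \<gamma>"
  by (auto simp: edges_image_def drawing_image_def)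

text \<open>Only \<open>P\<close> and \<open>Q\<close> must have inner vertices:
  \<open>R = []\<close> makes the chord from \<open>a\<close> to \<open>b\<close> the third
  arc.\<close>

lemma theta_of_walks:
  assumes dist: "distinct (a # b # P @ Q @ R)" and ne: "P \<noteq> []" "Q \<noteq> []"
    and w: "walk (parcs G) (a # P @ [b])" "walk (parcs G) (a # Q @ [b])" "walk (parcs G) (a # R @ [b])"
  obtains g1 g2 g3 where "theta (pos a) (pos b) g1 g2 g3"
    "path_image g1 = edges_image (walk_edges (a # P @ [b]))"
    "path_image g2 = edges_image (walk_edges (a # Q @ [b]))"
    "path_image g3 = edges_image (walk_edges (a # R @ [b]))"
proof -
  have arc: "\<exists>g. arc g \<and> pathstart g = pos a \<and> pathfinish g = pos b \<and> path_image g = edges_image (walk_edges (a # S @ [b]))"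
    if "S \<in> {P, Q, R}" for S
    using walk_arc[of "a # S @ [b]"] that dist w by auto
  obtain g1 where g1: "arc g1" "pathstart g1 = pos a" "pathfinish g1 = pos b"
    "path_image g1 = edges_image (walk_edges (a # P @ [b]))" using arc[of P] by auto
  obtain g2 where g2: "arc g2" "pathstart g2 = pos a" "pathfinish g2 = pos b"
    "path_image g2 = edges_image (walk_edges (a # Q @ [b]))" using arc[of Q] by auto
  obtain g3 where g3: "arc g3" "pathstart g3 = pos a" "pathfinish g3 = pos b"
    "path_image g3 = edges_image (walk_edges (a # R @ [b]))" using arc[of R] by auto
  have inter: "edges_image (walk_edges (a # S @ [b])) \<inter> edges_image (walk_edges (a # T @ [b])) = {pos a, pos b}"
    if ST: "S \<noteq> []" "distinct (a # b # S @ T)" "walk (parcs G) (a # S @ [b])" "walk (parcs G) (a # T @ [b])" for S T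
  proof -
    let ?S = "walk_edges (a # S @ [b])" and ?T = "walk_edges (a # T @ [b])"
    have U: "?S \<subseteq> uedges G" "?T \<subseteq> uedges G" using ST walk_edges_uedges by auto
    have un: "\<Union>?S = set (a # S @ [b])" "\<Union>?T = set (a # T @ [b])"
      by (rule in_Union_walk_edges, simp)+
    \<comment> \<open>A common edge could only be \<open>{a, b}\<close>, which a path with inner
      vertices does not use.\<close>
    have "?S \<inter> ?T = {}"
    proof (rule ccontr)
      assume "?S \<inter> ?T \<noteq> {}"
      then obtain e where e: "e \<in> ?S" "e \<in> ?T" by blast
      then have "e \<in> uedges G" using U by blast
      then obtain x y where "e = {x, y}" "x \<noteq> y" using pg.pair_no_loops by (fastforce simp: uedges_def)
      moreover have "e \<subseteq> {a, b}" using walk_edges_subset[OF e(1)] walk_edges_subset[OF e(2)] ST(2) by auto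
      ultimately have "e = {a, b}" by (simp add: insert_subset doubleton_eq_iff) blast
      then show False using e walk_edges_ends[of a S b] ST by auto
    qed
    then have "edges_image ?S \<inter> edges_image ?T \<subseteq> pos ` {a, b}"
      using edges_image_inter[OF U] un ST(2) by auto
    moreover have "a \<in> pverts G" "b \<in> pverts G" using walk_verts[OF ST(3)] by auto
    then have "pos a \<in> edges_image ?S \<inter> edges_image ?T" "pos b \<in> edges_image ?S \<inter> edges_image ?T"
      using vertex_in_edges_image U un by auto
    ultimately show ?thesis by auto
  qed
  have d: "distinct (a # b # P @ Q)" "distinct (a # b # P @ R)" "distinct (a # b # Q @ R)"
    using dist by (auto simp: Int_Un_distrib)
  have "pos a \<noteq> pos b"
    using drawing walk_verts[OF w(1)] dist by (auto simp: is_drawing_def inj_on_def)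
  then have "theta (pos a) (pos b) g1 g2 g3"
    using g1 g2 g3 inter[OF ne(1) d(1) w(1,2)] inter[OF ne(1) d(2) w(1,3)] inter[OF ne(2) d(3) w(2,3)]
    by (simp add: theta_def)
  then show ?thesis using that g1 g2 g3 by blast
qed

lemma interior_vertex:
  assumes "walk (parcs G) (a # P @ [b])" "distinct (a # P @ [b])" "v \<in> set P"
  shows "pos v \<in> edges_image (walk_edges (a # P @ [b])) - {pos a, pos b}"
    "pos v \<in> frontier (outside (drawing_image G pos \<gamma>))"
proof -
  have V: "set (a # P @ [b]) \<subseteq> pverts G" using walk_verts[OF assms(1)] by simp
  then have "v \<in> pverts G" "a \<in> pverts G" "b \<in> pverts G" using assms by auto
  moreover have "v \<noteq> a" "v \<noteq> b" using assms by auto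
  ultimately have "pos v \<noteq> pos a" "pos v \<noteq> pos b"
    using drawing by (auto simp: is_drawing_def dest: inj_onD)
  moreover have "pos v \<in> edges_image (walk_edges (a # P @ [b]))"
    using vertex_in_edges_image[OF walk_edges_uedges[OF assms(1)] \<open>v \<in> pverts G\<close>] assms
      in_Union_walk_edges[of "a # P @ [b]"] by auto
  ultimately show "pos v \<in> edges_image (walk_edges (a # P @ [b])) - {pos a, pos b}" by simp
  show "pos v \<in> frontier (outside (drawing_image G pos \<gamma>))" using outer \<open>v \<in> pverts G\<close> by blast
qed

lemma outerplane_theta_free: "theta_free (parcs G)"
  unfolding theta_free_def
proof (intro notI, elim exE conjE)
  fix a b P Q R
  assume ne: "P \<noteq> []" "Q \<noteq> []" "R \<noteq> []" and dist: "distinct (a # b # P @ Q @ R)"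
    and w: "walk (parcs G) (a # P @ [b])" "walk (parcs G) (a # Q @ [b])" "walk (parcs G) (a # R @ [b])"
  obtain g1 g2 g3 where g: "theta (pos a) (pos b) g1 g2 g3"
    "path_image g1 = edges_image (walk_edges (a # P @ [b]))"
    "path_image g2 = edges_image (walk_edges (a # Q @ [b]))"
    "path_image g3 = edges_image (walk_edges (a # R @ [b]))"
    using theta_of_walks[OF dist ne(1,2) w] .
  have "path_image g1 \<subseteq> drawing_image G pos \<gamma>" "path_image g2 \<subseteq> drawing_image G pos \<gamma>"
    "path_image g3 \<subseteq> drawing_image G pos \<gamma>"
    using g edges_image_subset walk_edges_uedges w by auto
  then show False
    using no_theta_on_outer_face[OF g(1), of _ "pos (hd P)" "pos (hd Q)" "pos (hd R)"] ne dist
      interior_vertex[OF w(1), of "hd P"] interior_vertex[OF w(2), of "hd Q"] interior_vertex[OF w(3), of "hd R"] g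
    by auto
qed

lemma outerplane_no_crossed_cycle: "\<not> crossed_cycle (parcs G) A B C D"
proof
  assume cc: "crossed_cycle (parcs G) A B C D"
  have E: "sym (parcs G)" using pg.pair_sym_arcs by (simp add: symmetric_def)
  \<comment> \<open>The cyclic order is \<open>a\<close>, \<open>c\<close>, \<open>b\<close>,
    \<open>d\<close>, so that the chords join \<open>a\<close> to \<open>b\<close> and
    \<open>c\<close> to \<open>d\<close> as in
    \<open>no_crossing_chords_on_outer_face\<close>.\<close>
  obtain a A' c B' b C' d D' where ABCD: "A = a # A'" "B = c # B'" "C = b # C'" "D = d # D'"
    using cc unfolding crossed_cycle_def by (metis list.exhaust)
  have dist: "distinct (a # A' @ c # B' @ b # C' @ d # D')"
    and ab: "(a, b) \<in> parcs G" and cd: "(c, d) \<in> parcs G"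
    and cyc: "walk (parcs G) (a # A' @ c # B' @ b # C' @ d # D')" "(last (d # D'), a) \<in> parcs G"
    using cc by (simp_all add: crossed_cycle_def cyclic_walk_def ABCD)
  \<comment> \<open>The closed walk is cut at \<open>a\<close> and \<open>b\<close> into
    \<open>w1\<close> and \<open>w2\<close>, and at \<open>c\<close> and \<open>d\<close> into
    \<open>w3\<close> and \<open>w4\<close>; each pair runs between the ends of one chord.\<close>
  have cl: "walk (parcs G) ((a # A' @ c # B' @ b # C' @ d # D') @ [a])"
    using cyc by (subst successively_append_iff) auto
  have w1: "walk (parcs G) (a # (A' @ c # B') @ [b])"
    using cl successively_append_iff[of _ "a # (A' @ c # B') @ [b]" "C' @ d # D' @ [a]"] by simp
  have w2': "walk (parcs G) (b # (C' @ d # D') @ [a])"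
    using cl successively_append_iff[of _ "a # A' @ c # B'" "b # (C' @ d # D') @ [a]"] by simp
  then have w2: "walk (parcs G) (a # rev (C' @ d # D') @ [b])"
    using walk_rev[OF E, of "b # (C' @ d # D') @ [a]"] by simp
  have w3: "walk (parcs G) (c # (B' @ b # C') @ [d])"
    using cl successively_append_iff[of _ "a # A'" "c # B' @ b # C' @ d # D' @ [a]"]
      successively_append_iff[of _ "c # (B' @ b # C') @ [d]" "D' @ [a]"] by simp
  have w4': "walk (parcs G) (d # (D' @ a # A') @ [c])"
  proof -
    have "walk (parcs G) (d # D' @ [a])"
      using cl successively_append_iff[of _ "a # A' @ c # B' @ b # C'" "d # D' @ [a]"] by simp
    moreover have "walk (parcs G) (a # A' @ [c])"
      using cl successively_append_iff[of _ "a # A' @ [c]" "B' @ b # C' @ d # D' @ [a]"] by simp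
    ultimately show ?thesis
      using successively_append_iff[of _ "d # D'" "[a]"] successively_append_iff[of _ "d # D'" "a # A' @ [c]"]
      by simp
  qed
  then have w4: "walk (parcs G) (c # rev (D' @ a # A') @ [d])"
    using walk_rev[OF E, of "d # (D' @ a # A') @ [c]"] by simp
  obtain g1 g2 g3 where g: "theta (pos a) (pos b) g1 g2 g3"
    "path_image g1 = edges_image (walk_edges (a # (A' @ c # B') @ [b]))"
    "path_image g2 = edges_image (walk_edges (a # rev (C' @ d # D') @ [b]))"
    "path_image g3 = edges_image (walk_edges (a # [] @ [b]))"
    by (rule theta_of_walks[of a b "A' @ c # B'" "rev (C' @ d # D')" "[]"]) (use dist w1 w2 ab in auto)
  obtain h1 h2 h3 where h: "theta (pos c) (pos d) h1 h2 h3"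
    "path_image h1 = edges_image (walk_edges (c # rev (D' @ a # A') @ [d]))"
    "path_image h2 = edges_image (walk_edges (c # (B' @ b # C') @ [d]))"
    "path_image h3 = edges_image (walk_edges (c # [] @ [d]))"
    by (rule theta_of_walks[of c d "rev (D' @ a # A')" "B' @ b # C'" "[]"]) (use dist w3 w4 cd in auto)
  have r: "walk_edges (a # rev (C' @ d # D') @ [b]) = walk_edges (b # (C' @ d # D') @ [a])"
    "walk_edges (c # rev (D' @ a # A') @ [d]) = walk_edges (d # (D' @ a # A') @ [c])"
    using walk_edges_rev[of "b # (C' @ d # D') @ [a]"] walk_edges_rev[of "d # (D' @ a # A') @ [c]"] by simp_all
  \<comment> \<open>Splitting all four sides at their inner chord ends shows that both pairs have
    the same cycle as image.\<close>
  have split: "walk_edges (x # (X @ y # Y) @ [z]) = walk_edges (x # X @ [y]) \<union> walk_edges (y # Y @ [z])" for x X y Y z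
    using walk_edges_append[of "x # X" "y # Y @ [z]"] walk_edges_append[of "x # X" "[y]"] by simp
  have img: "path_image h1 \<union> path_image h2 = path_image g1 \<union> path_image g2"
    unfolding g h r split by (auto simp: edges_image_def)
  have sub: "path_image g1 \<subseteq> drawing_image G pos \<gamma>" "path_image g2 \<subseteq> drawing_image G pos \<gamma>"
    "path_image g3 \<subseteq> drawing_image G pos \<gamma>" "path_image h3 \<subseteq> drawing_image G pos \<gamma>"
    unfolding g h using walk_edges_uedges[OF w1] walk_edges_uedges[OF w2] ab cd
    by (auto intro!: edges_image_subset) (auto simp: uedges_def)
  have "edges_image {{a, b}} \<inter> edges_image {{c, d}} \<subseteq> pos ` (\<Union>{{a, b}} \<inter> \<Union>{{c, d}})"
    using ab cd dist by (intro edges_image_inter) (auto simp: uedges_def doubleton_eq_iff)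
  also have "\<dots> = {}" using dist by auto
  finally have disj: "path_image g3 \<inter> path_image h3 = {}" using g h by auto
  show False
    using no_crossing_chords_on_outer_face[OF g(1) h(1) img sub _ _ _ _ _ _ _ _ disj]
      interior_vertex[OF w1, of c] interior_vertex[OF w2, of d] interior_vertex[OF w4, of a] interior_vertex[OF w3, of b]
      dist g h by (auto simp: Int_Un_distrib Int_commute)
qed

end

subsection \<open>Graphs and their symmetric relations\<close>

lemma pair_graph_iff:
  "pair_graph G \<longleftrightarrow> finite (pverts G) \<and> parcs G \<subseteq> pverts G \<times> pverts G \<and> sym (parcs G) \<and> irrefl (parcs G)"
proof
  assume "pair_graph G"
  then interpret pair_graph G .
  show "finite (pverts G) \<and> parcs G \<subseteq> pverts G \<times> pverts G \<and> sym (parcs G) \<and> irrefl (parcs G)"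
    using pair_sym_arcs pair_no_loops pair_finite_verts
    by (auto simp: symmetric_def irrefl_def dest: wellformed') fastforce
next
  assume *: "finite (pverts G) \<and> parcs G \<subseteq> pverts G \<times> pverts G \<and> sym (parcs G) \<and> irrefl (parcs G)"
  then have "finite (parcs G)" by (meson finite_SigmaI finite_subset)
  then show "pair_graph G" using * by unfold_locales (auto simp: symmetric_def irrefl_def)
qed

text \<open>Only pairs inside \<open>X\<close> are ever used, so connectivity may be tested in the
  whole graph or in any subgraph with the same edges on \<open>X\<close>.\<close>

lemma rtrancl_on_restrict:
  assumes "F \<inter> X \<times> X = E \<inter> X \<times> X"
  shows "rtrancl_on X F = rtrancl_on X E"
proof -
  have "(u, v) \<in> rtrancl_on X E'" if "(u, v) \<in> rtrancl_on X F'" "F' \<inter> X \<times> X \<subseteq> E'" for u v E' F'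
    using that by (induction rule: rtrancl_on_induct) (auto intro: rtrancl_on_into_rtrancl_on)
  moreover have "F \<inter> X \<times> X \<subseteq> E" "E \<inter> X \<times> X \<subseteq> F" using assms by blast+
  ultimately show ?thesis by (intro equalityI subrelI) blast+
qed

lemma connected_on_restrict:
  "F \<inter> X \<times> X = E \<inter> X \<times> X \<Longrightarrow> connected_on F X \<longleftrightarrow> connected_on E X"
  unfolding connected_on_def by (simp only: rtrancl_on_restrict[of F X E])

text \<open>The library passes to the symmetric closure of the arcs, which changes nothing for
  symmetric \<open>arcs H\<close>.\<close>

lemma connected_iff_connected_on:
  assumes "sym (arcs H)" "tail H = fst" "head H = snd"
  shows "Digraph_Component.connected H \<longleftrightarrow> connected_on (arcs H) (verts H)"
proof -
  have "(\<Union>e \<in> arcs H. {(fst e, snd e), (snd e, fst e)}) = arcs H"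
    using assms(1) by (auto dest: symD)
  then show ?thesis
    by (simp add: connected_def strongly_connected_def mk_symmetric_def reachable_def connected_on_def assms)
qed

lemma connected_induce_subgraph:
  assumes "sym (parcs G)"
  shows "Digraph_Component.connected (induce_subgraph (with_proj G) X) \<longleftrightarrow> connected_on (parcs G) X"
proof -
  have "sym (arcs (induce_subgraph (with_proj G) X))"
    using assms by (auto simp: induce_subgraph_def sym_def)
  then have "Digraph_Component.connected (induce_subgraph (with_proj G) X) \<longleftrightarrow>
      connected_on (arcs (induce_subgraph (with_proj G) X)) X"
    by (subst connected_iff_connected_on) (auto simp: induce_subgraph_def)
  also have "\<dots> \<longleftrightarrow> connected_on (parcs G) X"
    by (intro connected_on_restrict) (auto simp: induce_subgraph_def)
  finally show ?thesis .
qed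

lemma two_connected_iff:
  assumes "pair_graph G"
  shows "two_connected G \<longleftrightarrow> 3 \<le> card (pverts G) \<and> connected_on (parcs G) (pverts G) \<and>
    (\<forall>v \<in> pverts G. connected_on (parcs G) (pverts G - {v}))"
proof -
  have s: "sym (parcs G)" using assms by (simp add: pair_graph_iff)
  have "Digraph_Component.connected (pre_digraph.del_vert (with_proj G) v) \<longleftrightarrow>
      connected_on (parcs G) (pverts G - {v})" for v
  proof -
    let ?D = "pre_digraph.del_vert (with_proj G) v"
    have "Digraph_Component.connected ?D \<longleftrightarrow> connected_on (arcs ?D) (verts ?D)"
      using s by (intro connected_iff_connected_on) (auto simp: pre_digraph.del_vert_def sym_def)
    also have "\<dots> \<longleftrightarrow> connected_on (parcs G) (pverts G - {v})"
      by (auto simp: pre_digraph.del_vert_def intro!: connected_on_restrict)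
    finally show ?thesis .
  qed
  moreover have "Digraph_Component.connected (with_proj G) \<longleftrightarrow> connected_on (parcs G) (pverts G)"
    using s connected_iff_connected_on[of "with_proj G"] by simp
  ultimately show ?thesis using assms by (simp add: two_connected_def)
qed

lemma subgraph_iff:
  assumes "pair_graph H" "pair_graph G"
  shows "subgraph (with_proj H) (with_proj G) \<longleftrightarrow> pverts H \<subseteq> pverts G \<and> parcs H \<subseteq> parcs G"
proof -
  interpret H: pair_graph H by fact
  interpret G: pair_graph G by fact
  show ?thesis
    using H.wf_digraph_axioms G.wf_digraph_axioms by (auto simp: subgraph_def)
qed

lemma two_connected_in_block:
  assumes G: "pair_graph G" and H: "two_connected H" "subgraph (with_proj H) (with_proj G)"
  obtains B where "is_block B G" "two_connected B" "subgraph (with_proj H) (with_proj B)"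
proof -
  let ?P = "\<lambda>K. two_connected K \<and> subgraph (with_proj K) (with_proj G) \<and> subgraph (with_proj H) (with_proj K)"
  \<comment> \<open>Vertices and arcs are both counted, because a proper supergraph may have the
    same vertices.\<close>
  let ?m = "\<lambda>K. card (pverts K) + card (parcs K)"
  have fin: "finite (pverts K)" "finite (parcs K)" if "pair_graph K" for K :: "'a pair_pre_digraph"
    using that by (auto simp: pair_graph_iff intro: finite_subset)
  have pg: "pair_graph K" if "two_connected K" for K :: "'a pair_pre_digraph"
    using that by (simp add: two_connected_def)
  have "?m K \<le> ?m G" if "?P K" for K
    using that pg[of K] G fin[OF G] subgraph_iff[of K G] by (intro add_mono card_mono) auto
  moreover have "?P H" using H pg[of H] by (auto simp: subgraph_iff)
  ultimately obtain B where B: "?P B" "\<And>K. ?P K \<Longrightarrow> ?m K \<le> ?m B"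
    using ex_has_greatest_nat[of ?P H ?m "Suc (?m G)"] by (metis (no_types, lifting) le_imp_less_Suc)
  have "K = B" if K: "two_connected K" "subgraph (with_proj K) (with_proj G)" "subgraph (with_proj B) (with_proj K)" for K
  proof -
    have pgs: "pair_graph K" "pair_graph B" "pair_graph H" using pg K B H by auto
    have sub: "pverts B \<subseteq> pverts K" "parcs B \<subseteq> parcs K" using K pgs by (simp_all add: subgraph_iff)
    have "?P K" using K B pgs by (auto simp: subgraph_iff)
    then have "?m K \<le> ?m B" using B by blast
    moreover have "card (pverts B) \<le> card (pverts K)" "card (parcs B) \<le> card (parcs K)"
      using sub fin[OF pgs(1)] by (auto intro: card_mono)
    ultimately have "card (pverts B) = card (pverts K)" "card (parcs B) = card (parcs K)" by linarith+
    then have "pverts B = pverts K" "parcs B = parcs K"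
      using card_subset_eq[OF fin(1)[OF pgs(1)] sub(1)] card_subset_eq[OF fin(2)[OF pgs(1)] sub(2)] by blast+
    then show ?thesis by simp
  qed
  then have "is_block B G" using B unfolding is_block_def by blast
  then show ?thesis using B that by blast
qed

lemma is_block_cases:
  assumes G: "pair_graph G" and B: "is_block B G"
  shows "pair_graph B \<and> pverts B \<subseteq> pverts G \<and> parcs B \<subseteq> parcs G \<and>
    (two_connected B \<or> card (pverts B) = 1 \<or> card (pverts B) = 2)"
  using B unfolding is_block_def
proof (elim disjE exE conjE bexE)
  assume "two_connected B" "subgraph (with_proj B) (with_proj G)"
  then show ?thesis using G by (simp add: two_connected_def subgraph_iff)
next
  fix u v assume *: "is_bridge G u v" "B = \<lparr>pverts = {u, v}, parcs = {(u, v), (v, u)}\<rparr>"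
  then have "(u, v) \<in> parcs G" by (simp add: is_bridge_def)
  then show ?thesis using * G by (auto simp: pair_graph_iff irrefl_def sym_def card_insert_if)
next
  fix v assume "v \<in> pverts G" "B = \<lparr>pverts = {v}, parcs = {}\<rparr>"
  then show ?thesis by (simp add: pair_graph_iff irrefl_def sym_def)
qed

subsection \<open>Hamiltonian cycles as vertex lists\<close>

lemma pcas_walk:
  assumes "pcas u p v" "set p \<subseteq> E"
  shows "pawalk_verts u p = map fst p @ [v] \<and> walk E (map fst p @ [v]) \<and> hd (map fst p @ [v]) = u"
  using assms
proof (induction p arbitrary: u)
  case (Cons e p)
  then show ?case by (cases e) (auto simp: successively_Cons)
qed simp

lemma walk_pcas:
  assumes "walk E (xs @ [v])" "xs \<noteq> []"
  shows "\<exists>p. pcas (hd xs) p v \<and> set p \<subseteq> E \<and> map fst p = xs"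
  using assms(2,1)
proof (induction xs rule: list_nonempty_induct)
  case (single x)
  then show ?case by (intro exI[of _ "[(x, v)]"]) auto
next
  case (cons x xs)
  then obtain p where "pcas (hd xs) p v" "set p \<subseteq> E" "map fst p = xs" by (auto simp: successively_Cons)
  then show ?case using cons by (intro exI[of _ "(x, hd xs) # p"]) (auto simp: successively_Cons)
qed

lemma hamiltonian_iff:
  assumes "parcs G \<subseteq> pverts G \<times> pverts G"
  shows "hamiltonian G \<longleftrightarrow> 3 \<le> card (pverts G) \<and> (\<exists>xs. cyclic_walk (parcs G) xs \<and> set xs = pverts G)"
proof (cases "3 \<le> card (pverts G)")
  case True
  then have ne: "pverts G \<noteq> {}" by auto
  have cycle_iff: "pre_digraph.cycle (with_proj G) p \<longleftrightarrow>
      (\<exists>u. u \<in> pverts G \<and> set p \<subseteq> parcs G \<and> pcas u p u \<and> distinct (tl (pawalk_verts u p)) \<and> p \<noteq> [])" for p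
    by (auto simp: pre_digraph.cycle_def pre_digraph.awalk_def cas_with_proj_eq awalk_verts_with_proj_eq)
  show ?thesis
  proof
    assume "hamiltonian G"
    then obtain p u where p: "u \<in> pverts G" "set p \<subseteq> parcs G" "pcas u p u" "distinct (tl (pawalk_verts u p))"
      "p \<noteq> []" "fst ` set p = pverts G"
      unfolding hamiltonian_def cycle_iff by blast
    note w = pcas_walk[OF p(3,2)]
    have "hd (map fst p) = u" "map fst p \<noteq> []" using w p(5) by (auto simp: hd_append)
    \<comment> \<open>A closed walk lists \<open>u\<close> both first and last, and
      \<open>cycle\<close> ignores the first occurrence; one rotation moves the last one to the
      front.\<close>
    then have "distinct (tl (map fst p) @ [u])" "map fst p = u # tl (map fst p)"
      using w p(4) by (simp, metis list.collapse)
    then have "distinct (map fst p)" by (metis distinct.simps(2) distinct1_rotate rotate1.simps(2))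
    moreover have "walk (parcs G) (map fst p)" "(last (map fst p), hd (map fst p)) \<in> parcs G"
      using w \<open>map fst p \<noteq> []\<close> \<open>hd (map fst p) = u\<close> by (auto simp: successively_append_iff)
    ultimately have "cyclic_walk (parcs G) (map fst p)" by (simp add: cyclic_walk_def)
    moreover have "set (map fst p) = pverts G" using p by simp
    ultimately show "3 \<le> card (pverts G) \<and> (\<exists>xs. cyclic_walk (parcs G) xs \<and> set xs = pverts G)"
      using True by blast
  next
    assume "3 \<le> card (pverts G) \<and> (\<exists>xs. cyclic_walk (parcs G) xs \<and> set xs = pverts G)"
    then obtain xs where xs: "cyclic_walk (parcs G) xs" "set xs = pverts G" by blast
    then have xs_ne: "xs \<noteq> []" using ne by auto
    have "walk (parcs G) (xs @ [hd xs])"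
      using xs xs_ne by (auto simp: cyclic_walk_def successively_append_iff)
    then obtain p where p: "pcas (hd xs) p (hd xs)" "set p \<subseteq> parcs G" "map fst p = xs"
      using walk_pcas[of _ xs "hd xs"] xs_ne by blast
    have "pawalk_verts (hd xs) p = xs @ [hd xs]" using pcas_walk[OF p(1,2)] p(3) by simp
    moreover have "distinct (tl (xs @ [hd xs]))"
      using xs xs_ne by (cases xs) (auto simp: cyclic_walk_def)
    moreover have "hd xs \<in> pverts G" using xs(2) xs_ne hd_in_set by blast
    moreover have "p \<noteq> []" using xs_ne p(3) by blast
    moreover have "fst ` set p = pverts G" using xs(2) p(3) set_map[of fst p] by simp
    ultimately show "hamiltonian G"
      unfolding hamiltonian_def cycle_iff using p(1,2) True by (metis (no_types))
  qed
qed (simp add: hamiltonian_def)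

lemma walk_mono:
  assumes "walk E xs" "E \<subseteq> F"
  shows "walk F xs"
  using assms(2) by (intro successively_mono[OF assms(1)]) blast

lemma cyclic_walk_mono: "cyclic_walk E xs \<Longrightarrow> E \<subseteq> F \<Longrightarrow> cyclic_walk F xs"
  unfolding cyclic_walk_def by (auto intro: walk_mono[of E xs F])

lemma theta_free_mono:
  assumes "theta_free E" "F \<subseteq> E"
  shows "theta_free F"
  unfolding theta_free_def
proof (intro notI, elim exE conjE)
  fix a b P Q R
  assume "P \<noteq> []" "Q \<noteq> []" "R \<noteq> []" "distinct (a # b # P @ Q @ R)"
    "walk F (a # P @ [b])" "walk F (a # Q @ [b])" "walk F (a # R @ [b])"
  then show False
    using assms(1) walk_mono[OF _ assms(2)] unfolding theta_free_def by blast
qed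

subsection \<open>Minors\<close>

text \<open>The four arcs are the branch sets: consecutive ones are joined by edges of the cycle,
  opposite ones by the chords.\<close>

lemma crossed_cycle_K4_minor:
  assumes G: "pair_graph G" and cc: "crossed_cycle (parcs G) A B C D"
  shows "\<not> series_parallel G"
proof -
  let ?E = "parcs G"
  have s: "sym ?E" and sub: "?E \<subseteq> pverts G \<times> pverts G" using G by (auto simp: pair_graph_iff)
  define K :: "nat pair_pre_digraph" where
    "K = \<lparr>pverts = {0, 1, 2, 3}, parcs = {(x, y). x \<in> {0, 1, 2, 3} \<and> y \<in> {0, 1, 2, 3} \<and> x \<noteq> y}\<rparr>"
  have K4: "K\<^bsub>4\<^esub> (with_proj K)" by (auto simp: complete_digraph_pair_def K_def)
  define \<phi> where "\<phi> n = (if n = 0 then set A else if n = 1 then set B else if n = 2 then set C else set D)" for n :: nat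
  have ne: "A \<noteq> []" "B \<noteq> []" "C \<noteq> []" "D \<noteq> []" and cyc: "cyclic_walk ?E (A @ B @ C @ D)"
    and chords: "(hd A, hd C) \<in> ?E" "(hd B, hd D) \<in> ?E" using cc by (auto simp: crossed_cycle_def)
  have w: "walk ?E A" "walk ?E B" "walk ?E C" "walk ?E D"
    and adj: "(last A, hd B) \<in> ?E" "(last B, hd C) \<in> ?E" "(last C, hd D) \<in> ?E" "(last D, hd A) \<in> ?E"
    using cyc ne by (auto simp: cyclic_walk_def successively_append_iff hd_append)
  have mem: "hd xs \<in> set xs" "last xs \<in> set xs" if "xs \<noteq> []" for xs :: "'a list" using that by auto
  define R where "R X Y \<longleftrightarrow> (\<exists>u \<in> X. \<exists>v \<in> Y. (u, v) \<in> ?E)" for X Y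
  have edges: "R (set A) (set B)" "R (set B) (set C)" "R (set C) (set D)" "R (set D) (set A)"
    "R (set A) (set C)" "R (set B) (set D)"
    unfolding R_def using adj chords mem ne by blast+
  have flip: "R Y X" if "R X Y" for X Y
    using that symD[OF s] unfolding R_def by blast
  have conn: "connected_on ?E (set A)" "connected_on ?E (set B)" "connected_on ?E (set C)" "connected_on ?E (set D)"
    using connected_on_walk[OF s] w ne by blast+
  \<comment> \<open>\<open>crossed_cycle\<close> does not mention vertices of \<open>G\<close>; an
    arc has a vertex with an edge to another arc, and connectivity carries membership to the
    rest.\<close>
  have inV: "set xs \<subseteq> pverts G" if xs: "connected_on ?E (set xs)" "R (set xs) Y" for xs Y
  proof
    fix x assume x: "x \<in> set xs"
    obtain u where u: "u \<in> set xs" "u \<in> pverts G" using xs(2) sub unfolding R_def by blast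
    show "x \<in> pverts G"
      using connected_on_cut[OF xs(1), of u "pverts G" x] u x sub by blast
  qed
  have "is_minor K G"
    unfolding is_minor_def connected_induce_subgraph[OF s]
  proof (intro exI[of _ \<phi>] conjI)
    show "\<forall>x \<in> pverts K. \<phi> x \<subseteq> pverts G \<and> connected_on ?E (\<phi> x)"
      using conn inV[OF conn(1) edges(1)] inV[OF conn(2) edges(2)] inV[OF conn(3) edges(3)] inV[OF conn(4) edges(4)]
      by (simp add: K_def \<phi>_def)
    show "\<forall>x \<in> pverts K. \<forall>y \<in> pverts K. x \<noteq> y \<longrightarrow> \<phi> x \<inter> \<phi> y = {}"
      using cyc by (auto simp: K_def \<phi>_def cyclic_walk_def)
    have "R (\<phi> x) (\<phi> y)" if "(x, y) \<in> parcs K" for x y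
      using that edges edges[THEN flip] by (auto simp: K_def \<phi>_def)
    then show "\<forall>(x, y) \<in> parcs K. \<exists>u \<in> \<phi> x. \<exists>v \<in> \<phi> y. (u, v) \<in> ?E"
      unfolding R_def by blast
  qed
  then show ?thesis using K4 unfolding series_parallel_def by blast
qed

lemma noncrossing_series_parallel:
  assumes G: "pair_graph G" and f: "noncrossing (pverts G) (parcs G) f"
  shows "series_parallel G"
  unfolding series_parallel_def
proof (intro notI, elim exE conjE)
  fix K :: "nat pair_pre_digraph"
  assume K: "K\<^bsub>4\<^esub> (with_proj K)" and "is_minor K G"
  have s: "sym (parcs G)" using G by (simp add: pair_graph_iff)
  obtain \<phi> where \<phi>: "\<forall>x \<in> pverts K. \<phi> x \<subseteq> pverts G \<and> connected_on (parcs G) (\<phi> x)"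
    "\<forall>x \<in> pverts K. \<forall>y \<in> pverts K. x \<noteq> y \<longrightarrow> \<phi> x \<inter> \<phi> y = {}"
    "\<forall>(x, y) \<in> parcs K. \<exists>u \<in> \<phi> x. \<exists>v \<in> \<phi> y. (u, v) \<in> parcs G"
    using \<open>is_minor K G\<close> unfolding is_minor_def connected_induce_subgraph[OF s] by blast
  show False
    by (rule noncrossing_no_K4[OF f s, of "pverts K" \<phi>]) (use \<phi> K in \<open>auto simp: complete_digraph_pair_def\<close>)
qed

section \<open>Assembling the two inclusions\<close>

text \<open>A set \<open>H\<close> reached in the gluing induction need not be a block, so it is
  enlarged to a block \<open>B\<close>; the order along a hamiltonian cycle of \<open>B\<close> is
  then restricted to \<open>H\<close>.\<close>

lemma hamiltonian_blocks_noncrossing: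
  assumes G: "pair_graph G" and qh: "quasi_hamiltonian G" and nc: "\<And>A B C D. \<not> crossed_cycle (parcs G) A B C D"
  obtains f where "noncrossing (pverts G) (parcs G) f"
proof -
  let ?E = "parcs G"
  have fin: "finite (pverts G)" and s: "sym ?E" and sub: "?E \<subseteq> pverts G \<times> pverts G" and irr: "irrefl ?E"
    using G by (auto simp: pair_graph_iff)
  have "\<exists>f. noncrossing H (?E \<inter> H \<times> H) f"
    if H: "H \<subseteq> pverts G" "3 \<le> card H" "connected_on ?E H" "\<And>v. v \<in> H \<Longrightarrow> connected_on ?E (H - {v})" for H
  proof -
    let ?H = "\<lparr>pverts = H, parcs = ?E \<inter> H \<times> H\<rparr>"
    have pgH: "pair_graph ?H"
      using H(1) fin s irr by (auto simp: pair_graph_iff sym_def irrefl_def intro: finite_subset)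
    have "connected_on (?E \<inter> H \<times> H) X \<longleftrightarrow> connected_on ?E X" if "X \<subseteq> H" for X
      using that by (intro connected_on_restrict) blast
    then have "two_connected ?H"
      unfolding two_connected_iff[OF pgH] using H by auto
    moreover have "subgraph (with_proj ?H) (with_proj G)"
      unfolding subgraph_iff[OF pgH G] using H by auto
    ultimately obtain B where B: "is_block B G" "two_connected B" "subgraph (with_proj ?H) (with_proj B)"
      using two_connected_in_block[OF G] by blast
    have pgB: "pair_graph B" and card: "3 \<le> card (pverts B)" using B(2) by (auto simp: two_connected_def)
    have BG: "parcs B \<subseteq> ?E" using is_block_cases[OF G B(1)] by blast
    have HB: "H \<subseteq> pverts B" "?E \<inter> H \<times> H \<subseteq> parcs B" using B(3) pgH pgB by (auto simp: subgraph_iff)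
    have "hamiltonian B" using qh B(1) card unfolding quasi_hamiltonian_def by force
    then obtain xs where xs: "cyclic_walk ?E xs" "set xs = pverts B"
      using pgB cyclic_walk_mono[OF _ BG] by (auto simp: hamiltonian_iff pair_graph_iff)
    obtain f where "noncrossing (pverts B) (?E \<inter> pverts B \<times> pverts B) f"
      using noncrossing_cycle[OF xs nc] .
    then have "noncrossing H (?E \<inter> H \<times> H) f"
      using HB by (elim noncrossing_mono) auto
    then show ?thesis by blast
  qed
  then obtain f where "noncrossing (pverts G) (?E \<inter> pverts G \<times> pverts G) f"
    using noncrossing_of_two_connected[OF fin s] by blast
  moreover have "?E \<inter> pverts G \<times> pverts G = ?E" using sub by blast
  ultimately show ?thesis using that by metis
qed

lemma theta_free_quasi_hamiltonian:
  assumes G: "pair_graph G" and tf: "theta_free (parcs G)"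
  shows "quasi_hamiltonian G"
  unfolding quasi_hamiltonian_def
proof (intro allI impI)
  fix B assume B: "is_block B G"
  note bc = is_block_cases[OF G B]
  then have pgB: "pair_graph B" by blast
  then have pgB': "finite (pverts B)" "parcs B \<subseteq> pverts B \<times> pverts B" "sym (parcs B)" "irrefl (parcs B)"
    by (auto simp: pair_graph_iff)
  show "card (pverts B) = 1 \<or> card (pverts B) = 2 \<or> hamiltonian B"
  proof (cases "two_connected B")
    case True
    then have tc: "3 \<le> card (pverts B)" "connected_on (parcs B) (pverts B)"
      "\<And>v. v \<in> pverts B \<Longrightarrow> connected_on (parcs B) (pverts B - {v})"
      using two_connected_iff[OF pgB] by auto
    have "theta_free (parcs B)" using theta_free_mono[OF tf] bc by blast
    moreover have "2 \<le> card (pverts B)" using tc by linarith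
    ultimately obtain xs where "cyclic_walk (parcs B) xs" "set xs = pverts B"
      using theta_free_hamiltonian[OF pgB'(3,4) _ pgB'(1) _ tc(2,3)] by blast
    then show ?thesis using hamiltonian_iff[OF pgB'(2)] tc by blast
  qed (use bc in blast)
qed

lemma noncrossing_pseudo_outerplanar:
  assumes G: "pair_graph G" and f: "noncrossing (pverts G) (parcs G) f"
  shows "pseudo_outerplanar G"
  unfolding pseudo_outerplanar_def
proof (intro allI impI)
  fix B assume "is_block B G"
  note bc = is_block_cases[OF G this]
  then have "noncrossing (pverts B) (parcs B) f" using noncrossing_mono[OF f] by blast
  then obtain pos \<gamma> where d: "is_drawing B pos \<gamma>" "\<forall>e \<in> uedges B. \<forall>e' \<in> uedges B. \<not> crossing pos \<gamma> e e'"
    "pos ` pverts B \<subseteq> sphere 0 1" "\<forall>e \<in> uedges B. path_image (\<gamma> e) \<subseteq> cball 0 1"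
    using noncrossing_circle_drawing[of B f] bc by blast
  have "card {e' \<in> uedges B. crossing pos \<gamma> e e'} \<le> 1" if "e \<in> uedges B" for e
  proof -
    have "{e' \<in> uedges B. crossing pos \<gamma> e e'} = {}" using d that by blast
    then show ?thesis by (metis card.empty zero_le_one)
  qed
  then show "\<exists>c r pos \<gamma>. 0 < r \<and> is_drawing B pos \<gamma> \<and> pos ` pverts B \<subseteq> sphere c r \<and>
      (\<forall>e \<in> uedges B. path_image (\<gamma> e) \<subseteq> cball c r) \<and>
      (\<forall>e \<in> uedges B. card {f \<in> uedges B. crossing pos \<gamma> e f} \<le> 1)"
    using d by (intro exI[of _ 0] exI[of _ 1] exI[of _ pos] exI[of _ \<gamma>]) auto
qed

theorem theorem2p6:
  shows "(PH_graphs :: 'a pair_pre_digraph set) \<inter> S_graphs = O_graphs"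
proof (intro equalityI subsetI)
  fix G :: "'a pair_pre_digraph"
  assume "G \<in> PH_graphs \<inter> S_graphs"
  then have G: "pair_graph G" "quasi_hamiltonian G" "series_parallel G"
    by (auto simp: PH_graphs_def S_graphs_def)
  then obtain f where "noncrossing (pverts G) (parcs G) f"
    using hamiltonian_blocks_noncrossing crossed_cycle_K4_minor by metis
  then show "G \<in> O_graphs"
    using G noncrossing_imp_outerplanar by (auto simp: O_graphs_def)
next
  fix G :: "'a pair_pre_digraph"
  assume "G \<in> O_graphs"
  then have G: "pair_graph G" and "outerplanar G" by (auto simp: O_graphs_def)
  then obtain pos \<gamma> where "outerplane G pos \<gamma>"
    unfolding outerplanar_def outerplane_def by blast
  then interpret outerplane G pos \<gamma> .
  have qh: "quasi_hamiltonian G"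
    using theta_free_quasi_hamiltonian[OF G outerplane_theta_free] .
  \<comment> \<open>The given drawing has served to exclude the two configurations;
    pseudo-outerplanarity is then witnessed by the chord drawings obtained from
    \<open>f\<close>.\<close>
  then obtain f where "noncrossing (pverts G) (parcs G) f"
    using hamiltonian_blocks_noncrossing[OF G _ outerplane_no_crossed_cycle] by blast
  then show "G \<in> PH_graphs \<inter> S_graphs"
    using G qh noncrossing_pseudo_outerplanar noncrossing_series_parallel
    by (auto simp: PH_graphs_def S_graphs_def)
qed

end
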